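(* Let $n\ge3$, $\alpha\in(0,n)$, $p,q>0$ with $pq>1$, and assume $\frac{1}{p+1}+\frac{1}{q+1}\le\frac{n-\alpha}{n}$. If $(u,v)\in L^{r_0}(\mathbb{R}^n)\times L^{s_0}(\mathbb{R}^n)$, where $r_0=\frac{n(pq-1)}{\alpha(q+1)}$, $s_0=\frac{n(pq-1)}{\alpha(p+1)}$, is a pair of positive solutions of $$u(x)=\int_{\mathbb{R}^n}\frac{v^q(y)\,dy}{|x-y|^{n-\alpha}},\qquad v(x)=\int_{\mathbb{R}^n}\frac{u^p(y)\,dy}{|x-y|^{n-\alpha}},$$ then $(u,v)\in L^{p+1}(\mathbb{R}^n)\times L^{q+1}(\mathbb{R}^n)$.
   Context: Positive solutions are positive measurable functions satisfying both integral identities (finite) at every point. *)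

theory Defs
  imports "HOL-Analysis.Analysis"
begin

definition in_Lp :: "real \<Rightarrow> (real^'n \<Rightarrow> real) \<Rightarrow> bool" where
  "in_Lp r f \<longleftrightarrow> f \<in> borel_measurable lebesgue \<and>
     (\<integral>\<^sup>+ x. ennreal (\<bar>f x\<bar> powr r) \<partial>lebesgue) < \<infinity>"

text \<open>Riesz potential integral  \<integral> g(y)^e / |x-y|^(n-alpha) dy  as an extended
  nonnegative real (the integrand vanishes on the null set y = x).\<close>
definition riesz_int :: "real \<Rightarrow> real \<Rightarrow> (real^'n \<Rightarrow> real) \<Rightarrow> real^'n \<Rightarrow> ennreal" where
  "riesz_int \<alpha> e g x =
     (\<integral>\<^sup>+ y. ennreal (g y powr e / norm (x - y) powr (real CARD('n) - \<alpha>)) \<partial>lebesgue)"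

definition positive_solution :: "real \<Rightarrow> real \<Rightarrow> real \<Rightarrow> (real^'n \<Rightarrow> real) \<Rightarrow> (real^'n \<Rightarrow> real) \<Rightarrow> bool" where
  "positive_solution \<alpha> p q u v \<longleftrightarrow>
     u \<in> borel_measurable lebesgue \<and> v \<in> borel_measurable lebesgue \<and>
     (\<forall>x. u x > 0 \<and> v x > 0) \<and>
     (\<forall>x. riesz_int \<alpha> q v x = ennreal (u x) \<and> riesz_int \<alpha> p u x = ennreal (v x))"

end

theory Submission
  imports Defs
begin

text \<open>Write \<open>I\<close> for convolution with the kernel, so that \<open>u = I(v^q)\<close> and \<open>v = I(u^p)\<close>. Let \<open>E\<close> be the set where
  \<open>|x|\<close> and \<open>u\<close> are at most \<open>m\<close>, and \<open>c\<close> the restriction of \<open>u^(p - 1/q)\<close> to the complement of \<open>E\<close>. Then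
  \<open>v = F + I(c u^(1/q))\<close> with \<open>F = I(u^p 1_E)\<close>, and substituting \<open>u = I(v^q)\<close> makes the last term \<open>T v\<close> for the operator
  \<open>T w = I(c (I(w^q))^(1/q))\<close>, which is homogeneous of degree one and, up to a constant, subadditive. By the
  Hardy-Littlewood-Sobolev and Hoelder inequalities \<open>T\<close> is bounded both on \<open>L^s0\<close> and on \<open>L^(q+1)\<close>; since its norms
  are controlled by the integral of \<open>u^r0\<close> outside \<open>E\<close>, they are as small as one likes for large \<open>m\<close>. As
  \<open>F\<close> lies in \<open>L^(q+1)\<close>, iterating \<open>v = F + T v\<close> splits \<open>v\<close> into a part bounded in \<open>L^(q+1)\<close> and a part tending
  to zero in \<open>L^s0\<close>, whence \<open>v \<in> L^(q+1)\<close>. Exchanging the roles of \<open>u\<close> and \<open>v\<close>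
  gives the other half.\<close>

subsection \<open>Integrals of the kernel and Hoelder's inequality\<close>

text \<open>Layer-cake argument: \<open>1 / d powr b\<close> is the integral of
  \<open>b * r powr (- b - 1)\<close> over \<open>r \<ge> d\<close>. Tonelli's theorem then
  exchanges the two integrals, and for a fixed radius the points with
  \<open>norm (x - y) \<le> r\<close> form a ball.\<close>

lemma nn_integral_radial_layers:
  fixes x :: "'a::euclidean_space"
  assumes "0 < b" and [measurable]: "S \<in> sets borel"
  shows "(\<integral>\<^sup>+ y. ennreal (1 / norm (x - y) powr b) * indicator S y \<partial>lborel)
     \<le> (\<integral>\<^sup>+ r. ennreal (b * r powr (- b - 1)) * emeasure lborel (cball x r \<inter> S) \<partial>lborel)"
proof -
  have layer: "ennreal (1 / d powr b) \<le> (\<integral>\<^sup>+ r. ennreal (b * r powr (- b - 1)) * indicator {d..} r \<partial>lborel)"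
    if "0 \<le> d" for d :: real
  \<comment> \<open>At \<open>d = 0\<close> the convention \<open>1 / 0 = 0\<close> makes the left
    side vanish, so pointwise only an inequality can be claimed.\<close>
  proof (cases "d = 0")
    case False
    have "((\<lambda>r. r powr (- b - 1)) has_integral -(d powr (- b - 1 + 1)) / (- b - 1 + 1)) {d..}"
      using that False assms by (intro has_integral_powr_to_inf) auto
    from has_integral_mult_right[OF this, of b]
    have "((\<lambda>r. b * r powr (- b - 1)) has_integral 1 / d powr b) {d..}"
      using assms by (simp add: powr_minus field_simps)
    from nn_integral_has_integral_lebesgue'[OF _ this] show ?thesis
      using assms by simp
  qed auto
  have meas [measurable]: "(\<lambda>(y, r). indicator {norm (x - y)..} r :: ennreal) \<in> borel_measurable (lborel \<Otimes>\<^sub>M lborel)"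
  proof -
    have "(\<lambda>(y, r). indicator {norm (x - y)..} r :: ennreal) = indicator {z \<in> space (lborel \<Otimes>\<^sub>M lborel). norm (x - fst z) \<le> snd z}"
      by (auto simp: fun_eq_iff indicator_def space_pair_measure)
    also have "\<dots> \<in> borel_measurable (lborel \<Otimes>\<^sub>M lborel)"
      by measurable
    finally show ?thesis .
  qed
  have "(\<integral>\<^sup>+ y. ennreal (1 / norm (x - y) powr b) * indicator S y \<partial>lborel)
     \<le> (\<integral>\<^sup>+ y. (\<integral>\<^sup>+ r. ennreal (b * r powr (- b - 1)) * indicator {norm (x - y)..} r * indicator S y \<partial>lborel) \<partial>lborel)"
    by (auto intro!: nn_integral_mono mult_right_mono layer simp: nn_integral_multc)
  also have "\<dots> = (\<integral>\<^sup>+ r. (\<integral>\<^sup>+ y. ennreal (b * r powr (- b - 1)) * indicator {norm (x - y)..} r * indicator S y \<partial>lborel) \<partial>lborel)"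
    by (rule lborel_pair.Fubini') measurable
  also have "\<dots> = (\<integral>\<^sup>+ r. (\<integral>\<^sup>+ y. ennreal (b * r powr (- b - 1)) * indicator (cball x r \<inter> S) y \<partial>lborel) \<partial>lborel)"
    by (intro nn_integral_cong) (auto simp: indicator_def dist_norm)
  also have "\<dots> = (\<integral>\<^sup>+ r. ennreal (b * r powr (- b - 1)) * emeasure lborel (cball x r \<inter> S) \<partial>lborel)"
    by (intro nn_integral_cong) (auto simp: nn_integral_cmult_indicator)
  finally show ?thesis .
qed

lemma emeasure_cball_powr:
  fixes x :: "'a::euclidean_space"
  assumes "0 < r"
  shows "emeasure lborel (cball x r) = ennreal (unit_ball_vol DIM('a) * r powr DIM('a))"
proof -
  have "r powr DIM('a) = r ^ DIM('a)"
    using assms by (rule powr_realpow)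
  then show ?thesis
    using assms emeasure_cball[of r x] by (simp only: less_imp_le)
qed

text \<open>In the layer formula the measure is at most that of the ball of radius
  \<open>min r R\<close>. The resulting radial integrals converge at 0 because \<open>b\<close> is
  below the dimension, and at infinity because \<open>b > 0\<close>.\<close>

lemma nn_integral_kernel_inside:
  fixes b :: real
  assumes b: "0 < b" "b < real DIM('a)"
  shows "\<exists>C>0. \<forall>R>0. \<forall>x::'a::euclidean_space.
    (\<integral>\<^sup>+ y. ennreal (1 / norm (x - y) powr b) * indicator (ball x R) y \<partial>lborel)
      \<le> ennreal (C * R powr (DIM('a) - b))"
proof -
  define n where "n = real DIM('a)"
  define w where "w = unit_ball_vol n"
  have w: "w > 0" by (simp add: w_def n_def)
  have n: "n > b" using b by (simp add: n_def)
  \<comment> \<open>The first summand comes from the radii \<open>r \<le> R\<close>, the second from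
    \<open>r > R\<close>, where the factor \<open>b\<close> cancels.\<close>
  define C where "C = b * w / (n - b) + w"
  have "(\<integral>\<^sup>+ y. ennreal (1 / norm (x - y) powr b) * indicator (ball x R) y \<partial>lborel)
      \<le> ennreal (C * R powr (n - b))" if R: "R > 0" for R and x :: 'a
  proof -
    have "(\<integral>\<^sup>+ y. ennreal (1 / norm (x - y) powr b) * indicator (ball x R) y \<partial>lborel)
      \<le> (\<integral>\<^sup>+ r. ennreal (b * r powr (- b - 1)) * emeasure lborel (cball x r \<inter> ball x R) \<partial>lborel)"
      using b by (intro nn_integral_radial_layers) auto
    also have "\<dots> \<le> (\<integral>\<^sup>+ r. ennreal (b * w * r powr (n - b - 1)) * indicator {0..R} r
          + ennreal (b * w * R powr n * r powr (- b - 1)) * indicator {R..} r \<partial>lborel)"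
    proof (intro nn_integral_mono)
      fix r :: real
      consider "r < 0" | "r = 0" | "0 < r" "r \<le> R" | "R < r" by linarith
      then show "ennreal (b * r powr (- b - 1)) * emeasure lborel (cball x r \<inter> ball x R)
        \<le> ennreal (b * w * r powr (n - b - 1)) * indicator {0..R} r
          + ennreal (b * w * R powr n * r powr (- b - 1)) * indicator {R..} r"
      proof cases
        case 3
        have "emeasure lborel (cball x r \<inter> ball x R) \<le> emeasure lborel (cball x r)"
          by (intro emeasure_mono) auto
        also have "\<dots> = ennreal (w * r powr n)"
          using 3 by (simp add: emeasure_cball_powr w_def n_def)
        finally have "ennreal (b * r powr (- b - 1)) * emeasure lborel (cball x r \<inter> ball x R)
           \<le> ennreal (b * r powr (- b - 1)) * ennreal (w * r powr n)"
          by (rule mult_left_mono) auto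
        also have "\<dots> = ennreal (b * w * (r powr (- b - 1) * r powr n))"
          using b w by (simp add: ennreal_mult [symmetric] mult_ac)
        also have "r powr (- b - 1) * r powr n = r powr (n - b - 1)"
          by (simp add: powr_add [symmetric] algebra_simps)
        finally show ?thesis using 3 by (simp add: add_increasing2)
      next
        case 4
        have "emeasure lborel (cball x r \<inter> ball x R) \<le> emeasure lborel (cball x R)"
          by (intro emeasure_mono) auto
        also have "\<dots> = ennreal (w * R powr n)"
          using R by (simp add: emeasure_cball_powr w_def n_def)
        finally have "ennreal (b * r powr (- b - 1)) * emeasure lborel (cball x r \<inter> ball x R)
           \<le> ennreal (b * r powr (- b - 1)) * ennreal (w * R powr n)"
          by (rule mult_left_mono) auto
        also have "\<dots> = ennreal (b * w * R powr n * r powr (- b - 1))"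
          using b w by (simp add: ennreal_mult [symmetric] mult_ac)
        finally show ?thesis using 4 by simp
      qed auto
    qed
    also have "\<dots> = ennreal (b * w * (R powr (n - b) / (n - b))) + ennreal (b * w * R powr n * (R powr (- b) / b))"
    proof (subst nn_integral_add)
      have "((\<lambda>r. r powr (n - b - 1)) has_integral R powr (n - b - 1 + 1) / (n - b - 1 + 1)) {0..R}"
        using n R by (intro has_integral_powr_from_0) auto
      from has_integral_mult_right[OF this, of "b * w"]
      have 1: "((\<lambda>r. b * w * r powr (n - b - 1)) has_integral b * w * (R powr (n - b) / (n - b))) {0..R}"
        by simp
      have "((\<lambda>r. r powr (- b - 1)) has_integral -(R powr (- b - 1 + 1)) / (- b - 1 + 1)) {R..}"
        using R b by (intro has_integral_powr_to_inf) auto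
      from has_integral_mult_right[OF this, of "b * w * R powr n"]
      have 2: "((\<lambda>r. b * w * R powr n * r powr (- b - 1)) has_integral b * w * R powr n * (R powr (- b) / b)) {R..}"
        by simp
      show "integral\<^sup>N lborel (\<lambda>r. ennreal (b * w * r powr (n - b - 1)) * indicator {0..R} r)
         + integral\<^sup>N lborel (\<lambda>r. ennreal (b * w * R powr n * r powr (- b - 1)) * indicator {R..} r)
         = ennreal (b * w * (R powr (n - b) / (n - b))) + ennreal (b * w * R powr n * (R powr (- b) / b))"
        using b w by (simp add: nn_integral_has_integral_lebesgue'[OF _ 1] nn_integral_has_integral_lebesgue'[OF _ 2])
    qed auto
    also have "\<dots> = ennreal (C * R powr (n - b))"
      using b w n R by (simp add: C_def ennreal_plus [symmetric] powr_minus powr_diff field_simps del: ennreal_plus)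
    finally show ?thesis .
  qed
  moreover have "C > 0" using b w n by (simp add: C_def add_pos_pos)
  ultimately show ?thesis unfolding n_def by blast
qed

text \<open>The counterpart for an exponent above the dimension: a ball of radius
  \<open>r < R\<close> does not meet the complement of \<open>ball x R\<close>, so only radii
  \<open>r \<ge> R\<close> count, and there the radial integral converges at infinity.\<close>

lemma nn_integral_kernel_outside:
  fixes b :: real
  assumes b: "real DIM('a) < b"
  shows "\<exists>C>0. \<forall>R>0. \<forall>x::'a::euclidean_space.
    (\<integral>\<^sup>+ y. ennreal (1 / norm (x - y) powr b) * indicator (- ball x R) y \<partial>lborel)
      \<le> ennreal (C * R powr (DIM('a) - b))"
proof -
  define n where "n = real DIM('a)"
  define w where "w = unit_ball_vol n"
  have w: "w > 0" by (simp add: w_def n_def)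
  have n: "n < b" using b by (simp add: n_def)
  have b0: "0 < b" using b by (smt (verit) of_nat_0_le_iff)
  define C where "C = b * w / (b - n)"
  have "(\<integral>\<^sup>+ y. ennreal (1 / norm (x - y) powr b) * indicator (- ball x R) y \<partial>lborel)
      \<le> ennreal (C * R powr (n - b))" if R: "R > 0" for R and x :: 'a
  proof -
    have "(\<integral>\<^sup>+ y. ennreal (1 / norm (x - y) powr b) * indicator (- ball x R) y \<partial>lborel)
      \<le> (\<integral>\<^sup>+ r. ennreal (b * r powr (- b - 1)) * emeasure lborel (cball x r \<inter> - ball x R) \<partial>lborel)"
      using b0 by (intro nn_integral_radial_layers) auto
    also have "\<dots> \<le> (\<integral>\<^sup>+ r. ennreal (b * w * r powr (n - b - 1)) * indicator {R..} r \<partial>lborel)"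
    proof (intro nn_integral_mono)
      fix r :: real
      show "ennreal (b * r powr (- b - 1)) * emeasure lborel (cball x r \<inter> - ball x R)
        \<le> ennreal (b * w * r powr (n - b - 1)) * indicator {R..} r"
      proof (cases "R \<le> r")
        case True
        have "emeasure lborel (cball x r \<inter> - ball x R) \<le> emeasure lborel (cball x r)"
          by (intro emeasure_mono) auto
        also have "\<dots> = ennreal (w * r powr n)"
          using True R by (simp add: emeasure_cball_powr w_def n_def)
        finally have "ennreal (b * r powr (- b - 1)) * emeasure lborel (cball x r \<inter> - ball x R)
           \<le> ennreal (b * r powr (- b - 1)) * ennreal (w * r powr n)"
          by (rule mult_left_mono) auto
        also have "\<dots> = ennreal (b * w * (r powr (- b - 1) * r powr n))"
          using b0 w by (simp add: ennreal_mult [symmetric] mult_ac)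
        also have "r powr (- b - 1) * r powr n = r powr (n - b - 1)"
          by (simp add: powr_add [symmetric] algebra_simps)
        finally show ?thesis using True by simp
      next
        case False
        then have "cball x r \<inter> - ball x R = {}" by auto
        then show ?thesis by simp
      qed
    qed
    also have "\<dots> = ennreal (C * R powr (n - b))"
    proof -
      have "((\<lambda>r. r powr (n - b - 1)) has_integral -(R powr (n - b - 1 + 1)) / (n - b - 1 + 1)) {R..}"
        using R n by (intro has_integral_powr_to_inf) auto
      from has_integral_mult_right[OF this, of "b * w"]
      have "((\<lambda>r. b * w * r powr (n - b - 1)) has_integral C * R powr (n - b)) {R..}"
        using n by (simp add: C_def minus_divide_right del: minus_divide_left)
      from nn_integral_has_integral_lebesgue'[OF _ this] show ?thesis
        using b0 w by simp
    qed
    finally show ?thesis .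
  qed
  moreover have "C > 0" using b0 w n by (simp add: C_def)
  ultimately show ?thesis unfolding n_def by blast
qed

text \<open>Young's inequality is applied pointwise to \<open>f / A powr (1 / a)\<close> and
  \<open>g / B powr (1 / b)\<close> and integrated. Normalising by strictly positive upper bounds
  instead of by the norms themselves avoids a separate case for functions that vanish almost
  everywhere.\<close>

lemma nn_integral_Holder:
  fixes f g :: "'a \<Rightarrow> real"
  assumes [measurable]: "f \<in> borel_measurable M" "g \<in> borel_measurable M"
    and f: "\<And>x. 0 \<le> f x" and g: "\<And>x. 0 \<le> g x"
    and ab: "a > 1" "b > 1" "1 / a + 1 / b = 1"
    and A: "(\<integral>\<^sup>+ x. ennreal (f x powr a) \<partial>M) \<le> ennreal A" "0 < A"
    and B: "(\<integral>\<^sup>+ x. ennreal (g x powr b) \<partial>M) \<le> ennreal B" "0 < B"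
  shows "(\<integral>\<^sup>+ x. ennreal (f x * g x) \<partial>M) \<le> ennreal (A powr (1 / a) * B powr (1 / b))"
proof -
  define c where "c = A powr (1 / a) * B powr (1 / b)"
  have c: "c > 0" using A B by (simp add: c_def)
  have "ennreal (f x * g x) \<le> ennreal (c / (a * A)) * ennreal (f x powr a) + ennreal (c / (b * B)) * ennreal (g x powr b)" for x
  proof -
    have "(f x / A powr (1 / a)) * (g x / B powr (1 / b))
       \<le> (f x / A powr (1 / a)) powr a / a + (g x / B powr (1 / b)) powr b / b"
      using f g ab by (intro Youngs_inequality) auto
    also have "(f x / A powr (1 / a)) powr a = f x powr a / A"
      using f A(2) ab by (simp add: powr_divide powr_powr)
    also have "(g x / B powr (1 / b)) powr b = g x powr b / B"
      using g B(2) ab by (simp add: powr_divide powr_powr)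
    finally have "f x * g x \<le> c * (f x powr a / A / a + g x powr b / B / b)"
      using A B c by (simp add: c_def divide_simps mult_ac)
    also have "\<dots> = c / (a * A) * f x powr a + c / (b * B) * g x powr b"
      by (simp add: algebra_simps)
    finally show ?thesis
      using c ab A B by (simp add: ennreal_mult [symmetric] ennreal_plus [symmetric] ennreal_leI del: ennreal_plus)
  qed
  then have "(\<integral>\<^sup>+ x. ennreal (f x * g x) \<partial>M)
     \<le> (\<integral>\<^sup>+ x. ennreal (c / (a * A)) * ennreal (f x powr a) + ennreal (c / (b * B)) * ennreal (g x powr b) \<partial>M)"
    by (rule nn_integral_mono)
  also have "\<dots> = ennreal (c / (a * A)) * (\<integral>\<^sup>+ x. ennreal (f x powr a) \<partial>M) + ennreal (c / (b * B)) * (\<integral>\<^sup>+ x. ennreal (g x powr b) \<partial>M)"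
    by (simp add: nn_integral_add nn_integral_cmult)
  also have "\<dots> \<le> ennreal (c / (a * A)) * ennreal A + ennreal (c / (b * B)) * ennreal B"
    by (intro add_mono mult_left_mono A B) auto
  also have "\<dots> = ennreal (c * (1 / a + 1 / b))"
    using c ab(1,2) A B by (simp add: ennreal_mult [symmetric] ennreal_plus [symmetric] field_simps del: ennreal_plus)
  finally show ?thesis by (simp add: ab(3) c_def)
qed

subsection \<open>The Hardy-Littlewood-Sobolev inequality\<close>

text \<open>With \<open>b = DIM('a) - a\<close> this is the Riesz potential of order
  \<open>a\<close> up to a constant factor. The values are extended reals, so no convergence is
  presupposed; at \<open>y = x\<close> the quotient is 0.\<close>

definition riesz :: "real \<Rightarrow> ('a::euclidean_space \<Rightarrow> real) \<Rightarrow> 'a \<Rightarrow> ennreal" where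
  "riesz b f x = (\<integral>\<^sup>+ y. ennreal (f y / norm (x - y) powr b) \<partial>lborel)"

lemma riesz_measurable [measurable]:
  fixes f :: "'a::euclidean_space \<Rightarrow> real"
  assumes [measurable]: "f \<in> borel_measurable borel"
  shows "riesz b f \<in> borel_measurable borel"
proof -
  have "riesz b f \<in> borel_measurable lborel"
    unfolding riesz_def [abs_def]
    by (rule lborel.borel_measurable_nn_integral) measurable
  then show ?thesis by simp
qed

text \<open>Hoelder's inequality pairs \<open>f\<close> with the kernel cut off to the outside of
  the ball. The second condition on \<open>s\<close> says that the kernel raised to the conjugate
  exponent of \<open>s\<close> is integrable there.\<close>

lemma riesz_tail_bound:
  fixes b s :: real
  assumes b: "0 < b" and s: "s > 1" "DIM('a) < b * s / (s - 1)"
  shows "\<exists>C>0. \<forall>f::'a::euclidean_space \<Rightarrow> real. \<forall>R>0. \<forall>x.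
    f \<in> borel_measurable borel \<longrightarrow> (\<forall>y. 0 \<le> f y) \<longrightarrow> (\<integral>\<^sup>+ y. ennreal (f y powr s) \<partial>lborel) \<le> 1 \<longrightarrow>
    (\<integral>\<^sup>+ y. ennreal (f y / norm (x - y) powr b) * indicator (- ball x R) y \<partial>lborel)
      \<le> ennreal (C * R powr (DIM('a) * (1 - 1 / s) - b))"
proof -
  define s' where "s' = s / (s - 1)"
  have s': "s' > 1" "1 / s + 1 / s' = 1" using s by (auto simp: s'_def field_simps)
  have s'': "1 / s' = 1 - 1 / s" using s' by simp
  obtain K where K: "K > 0" and outside: "\<And>R (x::'a). R > 0 \<Longrightarrow>
      (\<integral>\<^sup>+ y. ennreal (1 / norm (x - y) powr (b * s')) * indicator (- ball x R) y \<partial>lborel)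
        \<le> ennreal (K * R powr (DIM('a) - b * s'))"
    using nn_integral_kernel_outside[of "b * s'", where 'a = 'a] s(2) by (auto simp: s'_def)
  show ?thesis
  proof (intro exI[of _ "K powr (1 / s')"] conjI allI impI)
    fix f :: "'a \<Rightarrow> real" and R :: real and x :: 'a
    assume R: "R > 0" and [measurable]: "f \<in> borel_measurable borel" and f0: "\<forall>y. 0 \<le> f y"
      and f1: "(\<integral>\<^sup>+ y. ennreal (f y powr s) \<partial>lborel) \<le> 1"
    define k where "k y = 1 / norm (x - y) powr b * indicator (- ball x R) y" for y
    have k0: "k y \<ge> 0" for y by (simp add: k_def)
    have [measurable]: "k \<in> borel_measurable borel" unfolding k_def by measurable
    have "(\<integral>\<^sup>+ y. ennreal (k y powr s') \<partial>lborel)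
       = (\<integral>\<^sup>+ y. ennreal (1 / norm (x - y) powr (b * s')) * indicator (- ball x R) y \<partial>lborel)"
      using s' by (intro nn_integral_cong) (auto simp: k_def indicator_def powr_divide powr_powr)
    also have "\<dots> \<le> ennreal (K * R powr (DIM('a) - b * s'))"
      by (rule outside[OF R])
    finally have k1: "(\<integral>\<^sup>+ y. ennreal (k y powr s') \<partial>lborel) \<le> ennreal (K * R powr (DIM('a) - b * s'))" .
    have "(\<integral>\<^sup>+ y. ennreal (f y / norm (x - y) powr b) * indicator (- ball x R) y \<partial>lborel)
        = (\<integral>\<^sup>+ y. ennreal (f y * k y) \<partial>lborel)"
      by (intro nn_integral_cong) (auto simp: k_def indicator_def)
    also have "\<dots> \<le> ennreal (1 powr (1 / s) * (K * R powr (DIM('a) - b * s')) powr (1 / s'))"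
      using f0 k0 s s' f1 k1 K R by (intro nn_integral_Holder) auto
    also have "1 powr (1 / s) * (K * R powr (DIM('a) - b * s')) powr (1 / s')
        = K powr (1 / s') * R powr (DIM('a) * (1 / s') - b)"
      using K s' by (simp add: powr_mult powr_powr diff_divide_distrib)
    finally show "(\<integral>\<^sup>+ y. ennreal (f y / norm (x - y) powr b) * indicator (- ball x R) y \<partial>lborel)
      \<le> ennreal (K powr (1 / s') * R powr (DIM('a) * (1 - 1 / s) - b))"
      by (simp add: s'')
  qed (use K in auto)
qed

lemma measurable_indicator_ball_pair [measurable]:
  "(\<lambda>(x, y). indicator (ball x R) (y::'a::euclidean_space) :: ennreal) \<in> borel_measurable (lborel \<Otimes>\<^sub>M lborel)"
proof -
  have "(\<lambda>(x, y). indicator (ball x R) y :: ennreal) = indicator {z \<in> space (lborel \<Otimes>\<^sub>M lborel). dist (fst z) (snd z::'a) < R}"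
    by (auto simp: fun_eq_iff indicator_def space_pair_measure)
  also have "\<dots> \<in> borel_measurable (lborel \<Otimes>\<^sub>M lborel)"
    by measurable
  finally show ?thesis .
qed

text \<open>After Tonelli's theorem the symmetry of the kernel and of \<open>dist x y < R\<close>
  lets the bound \<open>K\<close> be used with \<open>y\<close> as the centre.\<close>

lemma nn_integral_near_kernel:
  fixes f :: "'a::euclidean_space \<Rightarrow> real"
  assumes [measurable]: "f \<in> borel_measurable borel" and f0: "\<And>y. 0 \<le> f y"
    and K: "\<And>x::'a. (\<integral>\<^sup>+ y. ennreal (1 / norm (x - y) powr b) * indicator (ball x R) y \<partial>lborel) \<le> K"
  shows "(\<integral>\<^sup>+ x. (\<integral>\<^sup>+ y. ennreal (f y / norm (x - y) powr b) * indicator (ball x R) y \<partial>lborel) \<partial>lborel)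
     \<le> K * (\<integral>\<^sup>+ y. ennreal (f y) \<partial>lborel)"
proof -
  have "(\<integral>\<^sup>+ x. (\<integral>\<^sup>+ y. ennreal (f y / norm (x - y) powr b) * indicator (ball x R) y \<partial>lborel) \<partial>lborel)
     = (\<integral>\<^sup>+ y. (\<integral>\<^sup>+ x. ennreal (f y / norm (x - y) powr b) * indicator (ball x R) y \<partial>lborel) \<partial>lborel)"
    by (rule lborel_pair.Fubini' [symmetric]) measurable
  also have "\<dots> = (\<integral>\<^sup>+ y. (\<integral>\<^sup>+ x. ennreal (f y) * (ennreal (1 / norm (y - x) powr b) * indicator (ball y R) x) \<partial>lborel) \<partial>lborel)"
    using f0 by (intro nn_integral_cong)
      (auto simp: indicator_def dist_commute norm_minus_commute ennreal_mult' [symmetric])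
  also have "\<dots> = (\<integral>\<^sup>+ y. ennreal (f y) * (\<integral>\<^sup>+ x. ennreal (1 / norm (y - x) powr b) * indicator (ball y R) x \<partial>lborel) \<partial>lborel)"
    by (intro nn_integral_cong nn_integral_cmult) measurable
  also have "\<dots> \<le> (\<integral>\<^sup>+ y. ennreal (f y) * K \<partial>lborel)"
    by (intro nn_integral_mono mult_left_mono K) auto
  also have "\<dots> = K * (\<integral>\<^sup>+ y. ennreal (f y) \<partial>lborel)"
    by (simp add: nn_integral_multc mult.commute [of K])
  finally show ?thesis .
qed

text \<open>Where \<open>g \<ge> l\<close>, the tail accounts for at most \<open>l / 2\<close> of
  the potential and the part of \<open>f\<close> below height \<open>c\<close> inside the ball for
  at most \<open>c * K = l / 4\<close>. So the part of \<open>f\<close> above height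
  \<open>c\<close> contributes at least \<open>l / 4\<close> inside the ball, and Chebyshev's
  inequality with the bound of \<open>nn_integral_near_kernel\<close> estimates the measure.\<close>

lemma riesz_level_set:
  fixes f g :: "'a::euclidean_space \<Rightarrow> real"
  assumes [measurable]: "f \<in> borel_measurable borel" "g \<in> borel_measurable borel"
    and f0: "\<And>y. 0 \<le> f y" and g: "\<And>x. ennreal (g x) \<le> riesz b f x"
    and l: "l > 0" and c: "c > 0" and K: "K > 0" "c * K = l / 4"
    and inside: "\<And>x::'a. (\<integral>\<^sup>+ y. ennreal (1 / norm (x - y) powr b) * indicator (ball x R) y \<partial>lborel) \<le> ennreal K"
    and tail: "\<And>x. (\<integral>\<^sup>+ y. ennreal (f y / norm (x - y) powr b) * indicator (- ball x R) y \<partial>lborel) \<le> ennreal (l / 2)"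
  shows "(\<integral>\<^sup>+ x. indicator {x. l \<le> g x} x \<partial>lborel)
     \<le> ennreal (1 / c) * (\<integral>\<^sup>+ y. ennreal (f y) * indicator {y. c \<le> f y} y \<partial>lborel)"
proof -
  define h where "h y = f y * indicator {y. c \<le> f y} y" for y
  have h [measurable]: "h \<in> borel_measurable borel" unfolding h_def by measurable
  have h0: "h y \<ge> 0" for y using f0 by (simp add: h_def)
  define I where "I x = (\<integral>\<^sup>+ y. ennreal (h y / norm (x - y) powr b) * indicator (ball x R) y \<partial>lborel)" for x
  have I: "indicator {x. l \<le> g x} x \<le> ennreal (4 / l) * I x" for x
  proof (cases "l \<le> g x")
    case True
    have "ennreal l \<le> riesz b f x"
      using True g[of x] by (metis ennreal_leI order_trans)
    \<comment> \<open>Three pieces: the high part of \<open>f\<close> near \<open>x\<close>, its low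
      part near \<open>x\<close> replaced by the constant \<open>c\<close>, and everything far from
      \<open>x\<close>.\<close>
    also have "\<dots> \<le> (\<integral>\<^sup>+ y. ennreal (h y / norm (x - y) powr b) * indicator (ball x R) y
        + (ennreal c * (ennreal (1 / norm (x - y) powr b) * indicator (ball x R) y)
        + ennreal (f y / norm (x - y) powr b) * indicator (- ball x R) y) \<partial>lborel)"
      unfolding riesz_def using c
      by (intro nn_integral_mono)
        (auto simp: indicator_def h_def ennreal_mult' [symmetric] intro!: ennreal_leI divide_right_mono)
    also have "\<dots> = I x + (ennreal c * (\<integral>\<^sup>+ y. ennreal (1 / norm (x - y) powr b) * indicator (ball x R) y \<partial>lborel)
        + (\<integral>\<^sup>+ y. ennreal (f y / norm (x - y) powr b) * indicator (- ball x R) y \<partial>lborel))"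
      unfolding I_def by (simp add: nn_integral_add nn_integral_cmult)
    also have "\<dots> \<le> I x + (ennreal c * ennreal K + ennreal (l / 2))"
      by (intro add_mono mult_left_mono inside tail) auto
    also have "\<dots> = I x + ennreal (3 * l / 4)"
      using c K l by (simp add: ennreal_mult' [symmetric] ennreal_plus [symmetric] del: ennreal_plus)
    finally have le: "ennreal l \<le> I x + ennreal (3 * l / 4)" .
    have "ennreal (l / 4) \<le> I x"
    proof (cases "I x")
      case (real r)
      with le l have "l \<le> r + 3 * l / 4"
        by (simp add: ennreal_plus [symmetric] del: ennreal_plus)
      then show ?thesis using real l by (simp add: ennreal_leI)
    qed auto
    from mult_left_mono[OF this, of "ennreal (4 / l)"] show ?thesis
      using True l by (simp add: ennreal_mult' [symmetric])
  qed auto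
  have "(\<integral>\<^sup>+ x. indicator {x. l \<le> g x} x \<partial>lborel) \<le> (\<integral>\<^sup>+ x. ennreal (4 / l) * I x \<partial>lborel)"
    by (intro nn_integral_mono I)
  also have "\<dots> = ennreal (4 / l) * (\<integral>\<^sup>+ x. I x \<partial>lborel)"
  proof (rule nn_integral_cmult)
    show "I \<in> borel_measurable lborel"
      unfolding I_def [abs_def] by (rule lborel.borel_measurable_nn_integral) measurable
  qed
  also have "\<dots> \<le> ennreal (4 / l) * (ennreal K * (\<integral>\<^sup>+ y. ennreal (h y) \<partial>lborel))"
    unfolding I_def by (intro mult_left_mono nn_integral_near_kernel inside h h0) auto
  also have "\<dots> = ennreal (1 / c) * (\<integral>\<^sup>+ y. ennreal (h y) \<partial>lborel)"
  proof -
    have "4 / l * K = 1 / c" using K c l by (simp add: field_simps)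
    then show ?thesis
      using l K by (simp add: mult.assoc [symmetric] ennreal_mult' [symmetric])
  qed
  also have "(\<integral>\<^sup>+ y. ennreal (h y) \<partial>lborel) = (\<integral>\<^sup>+ y. ennreal (f y) * indicator {y. c \<le> f y} y \<partial>lborel)"
    by (intro nn_integral_cong) (auto simp: h_def indicator_def)
  finally show ?thesis .
qed

lemma nn_integral_powr_from_0:
  assumes "a > 0" "x \<ge> 0" "c \<ge> 0"
  shows "(\<integral>\<^sup>+ r. ennreal (c * r powr (a - 1)) * indicator {0..x} r \<partial>lborel) = ennreal (c * (x powr a / a))"
proof -
  have "((\<lambda>r. r powr (a - 1)) has_integral x powr (a - 1 + 1) / (a - 1 + 1)) {0..x}"
    using assms by (intro has_integral_powr_from_0) auto
  from has_integral_mult_right[OF this, of c]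
  have "((\<lambda>r. c * r powr (a - 1)) has_integral c * (x powr a / a)) {0..x}"
    by simp
  from nn_integral_has_integral_lebesgue'[OF _ this] show ?thesis
    using assms by simp
qed

text \<open>The kernel is split at a radius \<open>R\<close> and \<open>f\<close> at a height \<open>c\<close>, both powers of the level \<open>l\<close>, so that
  the far part and the low part together contribute at most \<open>3/4\<close> of \<open>l\<close>.\<close>

lemma Hardy_Littlewood_Sobolev_unit:
  fixes a s t :: real
  assumes a: "0 < a" "a < DIM('a)" and s: "s > 1" and t: "t > 0" "1 / t = 1 / s - a / DIM('a)"
  shows "\<exists>C>0. \<forall>f g::'a::euclidean_space \<Rightarrow> real.
    f \<in> borel_measurable borel \<longrightarrow> g \<in> borel_measurable borel \<longrightarrow> (\<forall>y. 0 \<le> f y) \<longrightarrow> (\<forall>x. 0 \<le> g x) \<longrightarrow>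
    (\<forall>x. ennreal (g x) \<le> riesz (DIM('a) - a) f x) \<longrightarrow>
    (\<integral>\<^sup>+ y. ennreal (f y powr s) \<partial>lborel) \<le> 1 \<longrightarrow>
    (\<integral>\<^sup>+ x. ennreal (g x powr t) \<partial>lborel) \<le> ennreal C"
proof -
  define n where "n = real DIM('a)"
  define b where "b = n - a"
  have n: "n > a" "n > 0" and b: "0 < b" "b < n" using a by (auto simp: n_def b_def)
  have tn: "n / t = n / s - a" using t n by (simp add: n_def field_simps)
  then have tn': "n * (1 - 1 / s) - b = - (n / t)" by (simp add: b_def algebra_simps)
  \<comment> \<open>Positivity of \<open>t\<close> forces this, and it is equivalent to the
    condition \<open>bs\<close> under which the tail bound is available.\<close>
  have "a * s < n"
  proof -
    have "0 < n / s - a" using tn t n by (metis divide_pos_pos)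
    then show ?thesis using s by (simp add: field_simps)
  qed
  then have bs: "n < b * s / (s - 1)" using s by (simp add: b_def field_simps)
  obtain K1 where K1: "K1 > 0" and inside: "\<And>R (x::'a). R > 0 \<Longrightarrow>
      (\<integral>\<^sup>+ y. ennreal (1 / norm (x - y) powr b) * indicator (ball x R) y \<partial>lborel) \<le> ennreal (K1 * R powr a)"
    using nn_integral_kernel_inside[where 'a = 'a, of b] b by (auto simp: n_def b_def)
  obtain K2 where K2: "K2 > 0" and tail: "\<And>(f::'a \<Rightarrow> real) R x. R > 0 \<Longrightarrow> f \<in> borel_measurable borel \<Longrightarrow>
      (\<And>y. 0 \<le> f y) \<Longrightarrow> (\<integral>\<^sup>+ y. ennreal (f y powr s) \<partial>lborel) \<le> 1 \<Longrightarrow>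
      (\<integral>\<^sup>+ y. ennreal (f y / norm (x - y) powr b) * indicator (- ball x R) y \<partial>lborel) \<le> ennreal (K2 * R powr (- (n / t)))"
    using riesz_tail_bound[where 'a = 'a, of b s] b s bs tn' unfolding n_def by auto
  \<comment> \<open>\<open>R l\<close> solves \<open>K2 * R l powr (- (n / t)) = l / 2\<close>,
    which bounds the tail; \<open>c l\<close> then solves
    \<open>c l * (K1 * R l powr a) = l / 4\<close>, which bounds the low part. The identity
    \<open>ts\<close> turns the resulting power of \<open>l\<close> in \<open>c l\<close> into
    \<open>t / s\<close>.\<close>
  define c0 where "c0 = (2 * K2) powr (- (a * t / n)) / (4 * K1)"
  have c0: "c0 > 0" using K1 K2 by (simp add: c0_def)
  define R where "R l = (l / (2 * K2)) powr (- (t / n))" for l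
  define c where "c l = c0 * l powr (t / s)" for l
  have ts: "1 + a * t / n = t / s" using t n by (simp add: n_def field_simps)
  have Rpos: "R l > 0" and cpos: "c l > 0" and cR: "c l * (K1 * R l powr a) = l / 4"
    and KR: "K2 * R l powr (- (n / t)) = l / 2" if l: "l > 0" for l
  proof -
    show "R l > 0" "c l > 0" using l K2 c0 by (auto simp: R_def c_def)
    show "K2 * R l powr (- (n / t)) = l / 2"
      using l K2 n t by (simp add: R_def powr_powr)
    have "R l powr a = l powr (- (a * t / n)) / (2 * K2) powr (- (a * t / n))"
      using l K2 by (simp add: R_def powr_powr powr_divide mult_ac)
    moreover have "l powr (t / s) = l * l powr (a * t / n)"
      using l by (simp add: ts [symmetric] powr_add)
    ultimately show "c l * (K1 * R l powr a) = l / 4"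
      using l K1 K2 by (simp add: c_def c0_def powr_minus)
  qed
  \<comment> \<open>Dividing \<open>l powr (t - 1)\<close> by \<open>c l\<close> leaves the power
    \<open>e - 1\<close> of \<open>l\<close>; it is integrable at 0 because \<open>s > 1\<close>
    makes \<open>e\<close> positive.\<close>
  define e where "e = t - t / s"
  have e: "e > 0" using s(1) t(1) by (simp add: e_def field_simps)
  define C where "C = t / c0 * (1 / c0) powr (s - 1) / e"
  show ?thesis
  proof (intro exI[of _ C] conjI allI impI)
    show "C > 0" using t c0 e by (simp add: C_def)
    fix f g :: "'a \<Rightarrow> real"
    assume [measurable]: "f \<in> borel_measurable borel" "g \<in> borel_measurable borel"
      and f0: "\<forall>y. 0 \<le> f y" and g0: "\<forall>x. 0 \<le> g x"
      and gf: "\<forall>x. ennreal (g x) \<le> riesz (DIM('a) - a) f x"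
      and f1: "(\<integral>\<^sup>+ y. ennreal (f y powr s) \<partial>lborel) \<le> 1"
    have gf': "ennreal (g x) \<le> riesz b f x" for x
      using gf by (simp add: b_def n_def)
    have [measurable]: "(\<lambda>(x, l). indicator {0..g x} l :: ennreal) \<in> borel_measurable (lborel \<Otimes>\<^sub>M lborel)"
    proof -
      have "(\<lambda>(x, l). indicator {0..g x} l :: ennreal) = indicator {z \<in> space (lborel \<Otimes>\<^sub>M lborel). 0 \<le> snd z \<and> snd z \<le> g (fst z)}"
        by (auto simp: fun_eq_iff indicator_def space_pair_measure)
      also have "\<dots> \<in> borel_measurable (lborel \<Otimes>\<^sub>M lborel)"
        by measurable
      finally show ?thesis .
    qed
    have [measurable]: "(\<lambda>(l, y). indicator {y. c l \<le> f y} y :: ennreal) \<in> borel_measurable (lborel \<Otimes>\<^sub>M lborel)"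
    proof -
      have "(\<lambda>(l, y). indicator {y. c l \<le> f y} y :: ennreal) = indicator {z \<in> space (lborel \<Otimes>\<^sub>M lborel). c0 * fst z powr (t / s) \<le> f (snd z)}"
        by (auto simp: fun_eq_iff indicator_def space_pair_measure c_def)
      also have "\<dots> \<in> borel_measurable (lborel \<Otimes>\<^sub>M lborel)"
        by measurable
      finally show ?thesis .
    qed
    \<comment> \<open>Layer-cake representation of \<open>g x powr t\<close>, so that every level
      \<open>l\<close> may use its own radius \<open>R l\<close> and height
      \<open>c l\<close>.\<close>
    have "(\<integral>\<^sup>+ x. ennreal (g x powr t) \<partial>lborel)
        = (\<integral>\<^sup>+ x. (\<integral>\<^sup>+ l. ennreal (t * l powr (t - 1)) * indicator {0..g x} l \<partial>lborel) \<partial>lborel)"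
      using t g0 by (intro nn_integral_cong) (simp add: nn_integral_powr_from_0)
    also have "\<dots> = (\<integral>\<^sup>+ l. (\<integral>\<^sup>+ x. ennreal (t * l powr (t - 1)) * indicator {0..g x} l \<partial>lborel) \<partial>lborel)"
      by (rule lborel_pair.Fubini') measurable
    also have "\<dots> \<le> (\<integral>\<^sup>+ l. (\<integral>\<^sup>+ y. ennreal (f y) * (ennreal (t / c0 * l powr (e - 1)) * indicator {0<..} l * indicator {y. c l \<le> f y} y) \<partial>lborel) \<partial>lborel)"
    proof (rule nn_integral_mono)
      fix l :: real
      show "(\<integral>\<^sup>+ x. ennreal (t * l powr (t - 1)) * indicator {0..g x} l \<partial>lborel)
         \<le> (\<integral>\<^sup>+ y. ennreal (f y) * (ennreal (t / c0 * l powr (e - 1)) * indicator {0<..} l * indicator {y. c l \<le> f y} y) \<partial>lborel)"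
      proof (cases "l > 0")
        case True
        have "(\<integral>\<^sup>+ x. ennreal (t * l powr (t - 1)) * indicator {0..g x} l \<partial>lborel)
            = (\<integral>\<^sup>+ x. ennreal (t * l powr (t - 1)) * indicator {x. l \<le> g x} x \<partial>lborel)"
          using True by (intro nn_integral_cong) (auto simp: indicator_def)
        also have "\<dots> = ennreal (t * l powr (t - 1)) * (\<integral>\<^sup>+ x. indicator {x. l \<le> g x} x \<partial>lborel)"
          by (rule nn_integral_cmult) measurable
        also have "\<dots> \<le> ennreal (t * l powr (t - 1)) * (ennreal (1 / c l) * (\<integral>\<^sup>+ y. ennreal (f y) * indicator {y. c l \<le> f y} y \<partial>lborel))"
          using f0 f1 gf' True K1
          by (intro mult_left_mono riesz_level_set[where K = "K1 * R l powr a" and R = "R l" and b = b])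
             (auto simp: cpos cR Rpos[OF True, THEN less_imp_neq, symmetric] Rpos KR intro!: inside tail[where R = "R l", unfolded KR[OF True]])
        also have "\<dots> = ennreal (t / c0 * l powr (e - 1)) * (\<integral>\<^sup>+ y. ennreal (f y) * indicator {y. c l \<le> f y} y \<partial>lborel)"
        proof -
          have "l powr (e - 1) = l powr (t - 1) / l powr (t / s)"
            by (simp add: powr_diff [symmetric] e_def algebra_simps)
          then have "t * l powr (t - 1) * (1 / c l) = t / c0 * l powr (e - 1)"
            by (simp add: c_def)
          then show ?thesis
            using t cpos[OF True] by (simp add: mult.assoc [symmetric] ennreal_mult' [symmetric])
        qed
        also have "\<dots> = (\<integral>\<^sup>+ y. ennreal (t / c0 * l powr (e - 1)) * (ennreal (f y) * indicator {y. c l \<le> f y} y) \<partial>lborel)"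
          by (rule nn_integral_cmult [symmetric]) measurable
        finally show ?thesis
          using True by (simp add: mult_ac)
      next
        case False
        \<comment> \<open>For \<open>l = 0\<close> the weight vanishes because
          \<open>0 powr (t - 1) = 0\<close>, whatever the sign of \<open>t - 1\<close>.\<close>
        then have "ennreal (t * l powr (t - 1)) * indicator {0..g x} l = 0" for x
          by (cases "l = 0") auto
        then show ?thesis by (simp only: nn_integral_const mult_zero_left zero_le)
      qed
    qed
    also have "\<dots> = (\<integral>\<^sup>+ y. (\<integral>\<^sup>+ l. ennreal (f y) * (ennreal (t / c0 * l powr (e - 1)) * indicator {0<..} l * indicator {y. c l \<le> f y} y) \<partial>lborel) \<partial>lborel)"
      by (rule lborel_pair.Fubini' [symmetric]) measurable
    also have "\<dots> \<le> (\<integral>\<^sup>+ y. ennreal C * ennreal (f y powr s) \<partial>lborel)"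
    proof (rule nn_integral_mono)
      fix y
      \<comment> \<open>The level with \<open>c z = f y\<close>: only \<open>l \<le> z\<close>
        satisfy \<open>c l \<le> f y\<close>. The integral up to \<open>z\<close> is a multiple of
        \<open>z powr e\<close>, hence of \<open>f y powr (s - 1)\<close>, and the factor
        \<open>f y\<close> completes the power \<open>s\<close>.\<close>
      define z where "z = (f y / c0) powr (s / t)"
      have "(\<integral>\<^sup>+ l. ennreal (f y) * (ennreal (t / c0 * l powr (e - 1)) * indicator {0<..} l * indicator {y. c l \<le> f y} y) \<partial>lborel)
         \<le> (\<integral>\<^sup>+ l. ennreal (f y) * (ennreal (t / c0 * l powr (e - 1)) * indicator {0..z} l) \<partial>lborel)"
      proof (intro nn_integral_mono mult_left_mono)
        fix l :: real
        have "l \<le> z" if l: "l > 0" "c l \<le> f y"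
        proof -
          have "l powr (t / s) \<le> f y / c0" using l c0 by (simp add: c_def field_simps)
          then have "(l powr (t / s)) powr (s / t) \<le> z"
            unfolding z_def using s t by (intro powr_mono2) auto
          then show ?thesis using l s t by (simp add: powr_powr)
        qed
        then show "ennreal (t / c0 * l powr (e - 1)) * indicator {0<..} l * indicator {y. c l \<le> f y} y
          \<le> ennreal (t / c0 * l powr (e - 1)) * indicator {0..z} l"
          by (auto simp: indicator_def)
      qed auto
      also have "\<dots> = ennreal (f y) * ennreal (t / c0 * (z powr e / e))"
        using e t c0 by (subst nn_integral_cmult, measurable, subst nn_integral_powr_from_0) (auto simp: z_def)
      also have "\<dots> = ennreal C * ennreal (f y powr s)"
      proof -
        have "s / t * e = s - 1" using s(1) t(1) by (simp add: e_def field_simps)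
        then have "z powr e = (f y / c0) powr (s - 1)"
          unfolding z_def powr_powr by simp
        also have "\<dots> = f y powr (s - 1) * (1 / c0) powr (s - 1)"
          using f0 c0 by (simp add: powr_divide)
        finally have "z powr e = f y powr (s - 1) * (1 / c0) powr (s - 1)" .
        moreover have "f y * f y powr (s - 1) = f y powr s"
          using f0 s by (cases "f y = 0") (auto simp: powr_mult_base less_le)
        ultimately have "f y * (t / c0 * (z powr e / e)) = C * f y powr s"
          by (simp add: C_def)
        then show ?thesis
          using f0 t c0 e \<open>C > 0\<close> by (simp add: ennreal_mult' [symmetric])
      qed
      finally show "(\<integral>\<^sup>+ l. ennreal (f y) * (ennreal (t / c0 * l powr (e - 1)) * indicator {0<..} l * indicator {y. c l \<le> f y} y) \<partial>lborel)
        \<le> ennreal C * ennreal (f y powr s)" .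
    qed
    also have "\<dots> = ennreal C * (\<integral>\<^sup>+ y. ennreal (f y powr s) \<partial>lborel)"
      by (rule nn_integral_cmult) measurable
    also have "\<dots> \<le> ennreal C"
      using mult_left_mono[OF f1, of "ennreal C"] by simp
    finally show "(\<integral>\<^sup>+ x. ennreal (g x powr t) \<partial>lborel) \<le> ennreal C" .
  qed
qed

section \<open>The inequality for arbitrary norms and for the weighted composite operator\<close>

lemma riesz_cmult:
  fixes f :: "'a::euclidean_space \<Rightarrow> real"
  assumes [measurable]: "f \<in> borel_measurable borel" and "c \<ge> 0"
  shows "riesz b (\<lambda>y. c * f y) x = ennreal c * riesz b f x"
proof -
  have "riesz b (\<lambda>y. c * f y) x = (\<integral>\<^sup>+ y. ennreal c * ennreal (f y / norm (x - y) powr b) \<partial>lborel)"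
    unfolding riesz_def using assms(2) by (intro nn_integral_cong) (simp add: ennreal_mult' [symmetric])
  also have "\<dots> = ennreal c * riesz b f x"
    unfolding riesz_def by (rule nn_integral_cmult) measurable
  finally show ?thesis .
qed

text \<open>Homogeneity of the potential reduces this to the normalised case. Taking any real
  \<open>g\<close> below the potential, instead of the potential itself, allows an application
  before the potential is known to be finite.\<close>

theorem Hardy_Littlewood_Sobolev:
  fixes a s t :: real
  assumes a: "0 < a" "a < DIM('a)" and s: "s > 1" and t: "t > 0" "1 / t = 1 / s - a / DIM('a)"
  obtains C where "C > 0" "\<And>(f::'a::euclidean_space \<Rightarrow> real) g A.
    f \<in> borel_measurable borel \<Longrightarrow> g \<in> borel_measurable borel \<Longrightarrow> (\<And>y. 0 \<le> f y) \<Longrightarrow> (\<And>x. 0 \<le> g x) \<Longrightarrow>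
    (\<And>x. ennreal (g x) \<le> riesz (DIM('a) - a) f x) \<Longrightarrow> A > 0 \<Longrightarrow>
    (\<integral>\<^sup>+ y. ennreal (f y powr s) \<partial>lborel) \<le> ennreal A \<Longrightarrow>
    (\<integral>\<^sup>+ x. ennreal (g x powr t) \<partial>lborel) \<le> ennreal (C * A powr (t / s))"
proof -
  obtain C where C: "C > 0" and unit: "\<And>f g::'a \<Rightarrow> real. f \<in> borel_measurable borel \<Longrightarrow> g \<in> borel_measurable borel \<Longrightarrow>
      (\<And>y. 0 \<le> f y) \<Longrightarrow> (\<And>x. 0 \<le> g x) \<Longrightarrow> (\<And>x. ennreal (g x) \<le> riesz (DIM('a) - a) f x) \<Longrightarrow>
      (\<integral>\<^sup>+ y. ennreal (f y powr s) \<partial>lborel) \<le> 1 \<Longrightarrow> (\<integral>\<^sup>+ x. ennreal (g x powr t) \<partial>lborel) \<le> ennreal C"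
    using Hardy_Littlewood_Sobolev_unit[OF a s t] by blast
  have "(\<integral>\<^sup>+ x. ennreal (g x powr t) \<partial>lborel) \<le> ennreal (C * A powr (t / s))"
    if [measurable]: "f \<in> borel_measurable borel" "g \<in> borel_measurable borel"
      and f0: "\<And>y. 0 \<le> f y" and g0: "\<And>x. 0 \<le> g x"
      and gf: "\<And>x. ennreal (g x) \<le> riesz (DIM('a) - a) f x" and A: "A > 0"
      and fA: "(\<integral>\<^sup>+ y. ennreal (f y powr s) \<partial>lborel) \<le> ennreal A"
    for f g :: "'a \<Rightarrow> real" and A
  proof -
    \<comment> \<open>This factor normalises \<open>f\<close>, since
      \<open>c powr s = 1 / A\<close>; \<open>ct\<close> undoes the same scaling of
      \<open>g\<close>.\<close>
    define c where "c = A powr (- 1 / s)"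
    have c: "c > 0" using A by (simp add: c_def)
    have cs: "c powr s = 1 / A" unfolding c_def powr_powr using A s by (simp add: powr_minus_divide)
    have ct: "c powr t * A powr (t / s) = 1"
      unfolding c_def powr_powr using A by (simp add: powr_add [symmetric])
    have "(\<integral>\<^sup>+ x. ennreal ((c * g x) powr t) \<partial>lborel) \<le> ennreal C"
    proof (rule unit[of "\<lambda>y. c * f y"])
      show "ennreal (c * g x) \<le> riesz (DIM('a) - a) (\<lambda>y. c * f y) x" for x
        using c mult_left_mono[OF gf, of "ennreal c" x] by (simp add: riesz_cmult ennreal_mult')
      have "(\<integral>\<^sup>+ y. ennreal ((c * f y) powr s) \<partial>lborel) = (\<integral>\<^sup>+ y. ennreal (1 / A) * ennreal (f y powr s) \<partial>lborel)"
        using A c f0 by (intro nn_integral_cong) (simp add: powr_mult cs ennreal_mult' [symmetric])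
      also have "\<dots> = ennreal (1 / A) * (\<integral>\<^sup>+ y. ennreal (f y powr s) \<partial>lborel)"
        by (rule nn_integral_cmult) measurable
      also have "\<dots> \<le> ennreal (1 / A) * ennreal A"
        by (intro mult_left_mono fA) auto
      also have "\<dots> = 1" using A by (simp add: ennreal_mult' [symmetric])
      finally show "(\<integral>\<^sup>+ y. ennreal ((c * f y) powr s) \<partial>lborel) \<le> 1" .
    qed (use c f0 g0 in auto)
    then have le: "ennreal (A powr (t / s)) * (\<integral>\<^sup>+ x. ennreal ((c * g x) powr t) \<partial>lborel) \<le> ennreal (A powr (t / s)) * ennreal C"
      by (rule mult_left_mono) auto
    have "ennreal (A powr (t / s)) * (\<integral>\<^sup>+ x. ennreal ((c * g x) powr t) \<partial>lborel)
        = (\<integral>\<^sup>+ x. ennreal (A powr (t / s)) * ennreal ((c * g x) powr t) \<partial>lborel)"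
      by (rule nn_integral_cmult [symmetric]) measurable
    also have "\<dots> = (\<integral>\<^sup>+ x. ennreal (g x powr t) \<partial>lborel)"
    proof (intro nn_integral_cong)
      fix x
      have "A powr (t / s) * (c * g x) powr t = (c powr t * A powr (t / s)) * g x powr t"
        using c g0 by (simp add: powr_mult)
      then show "ennreal (A powr (t / s)) * ennreal ((c * g x) powr t) = ennreal (g x powr t)"
        by (simp add: ct ennreal_mult' [symmetric])
    qed
    finally show ?thesis
      using le C by (simp add: ennreal_mult' [symmetric] mult.commute)
  qed
  with C that show ?thesis by blast
qed

text \<open>Two potentials with a Hoelder step between them: \<open>w powr q\<close> lies in the
  space of exponent \<open>s / q\<close>, so \<open>g\<close> lies in that of exponent
  \<open>t1\<close>. Multiplying \<open>g powr (1 / q)\<close> by \<open>c\<close> leads to the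
  exponent \<open>\<sigma>\<close>, and the second potential returns to \<open>s\<close>. The value
  of \<open>B\<close> is the one for which gains and losses of integrability cancel; the three
  conditions on \<open>s\<close> say that \<open>s / q > 1\<close>, \<open>t1 > 0\<close> and
  \<open>\<sigma> > 1\<close>.\<close>

lemma Hardy_Littlewood_Sobolev_composite:
  fixes a q s B :: real
  assumes a: "0 < a" "a < DIM('a)" and q: "q > 0" and B: "1 / B = a / DIM('a) * (1 + 1 / q)"
    and s: "s > q" "q / s > a / DIM('a)" "1 / s + a / DIM('a) < 1"
  obtains C where "C > 0" "\<And>(c::'a::euclidean_space \<Rightarrow> real) w g h A \<eta>.
    c \<in> borel_measurable borel \<Longrightarrow> w \<in> borel_measurable borel \<Longrightarrow>
    g \<in> borel_measurable borel \<Longrightarrow> h \<in> borel_measurable borel \<Longrightarrow>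
    (\<And>x. 0 \<le> c x) \<Longrightarrow> (\<And>x. 0 \<le> w x) \<Longrightarrow> (\<And>x. 0 \<le> g x) \<Longrightarrow> (\<And>x. 0 \<le> h x) \<Longrightarrow>
    (\<And>x. ennreal (g x) \<le> riesz (DIM('a) - a) (\<lambda>y. w y powr q) x) \<Longrightarrow>
    (\<And>x. ennreal (h x) \<le> riesz (DIM('a) - a) (\<lambda>y. c y * g y powr (1 / q)) x) \<Longrightarrow>
    A > 0 \<Longrightarrow> \<eta> > 0 \<Longrightarrow>
    (\<integral>\<^sup>+ x. ennreal (w x powr s) \<partial>lborel) \<le> ennreal A \<Longrightarrow>
    (\<integral>\<^sup>+ x. ennreal (c x powr B) \<partial>lborel) \<le> ennreal \<eta> \<Longrightarrow>
    (\<integral>\<^sup>+ x. ennreal (h x powr s) \<partial>lborel) \<le> ennreal (C * \<eta> powr (s / B) * A)"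
proof -
  define d where "d = a / DIM('a)"
  have d: "d > 0" using a by (simp add: d_def)
  have s0: "s > 0" using s q by simp
  have "1 / B > 0" unfolding B d_def [symmetric] using d q by (intro mult_pos_pos add_pos_pos) auto
  then have B0: "B > 0" by simp
  define t1 where "t1 = 1 / (q / s - d)"
  have t1: "t1 > 0" "1 / t1 = 1 / (s / q) - a / DIM('a)" using s by (auto simp: t1_def d_def)
  define \<sigma> where "\<sigma> = 1 / (1 / s + d)"
  have \<sigma>: "\<sigma> > 1" "1 / s = 1 / \<sigma> - a / DIM('a)"
    using s s0 d by (auto simp: \<sigma>_def d_def add_pos_pos)
  have \<sigma>0: "\<sigma> > 0" using \<sigma> by simp
  have qt1: "1 / (q * t1) = 1 / s - d / q" using q by (simp add: t1_def diff_divide_distrib)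
  \<comment> \<open>The Hoelder relation between the exponents of \<open>c\<close>, of
    \<open>g powr (1 / q)\<close> and of their product. Here the terms \<open>d / q\<close>
    cancel.\<close>
  have sum: "1 / B + 1 / (q * t1) = 1 / \<sigma>"
    using B q s0 unfolding qt1 by (simp add: \<sigma>_def d_def algebra_simps add_divide_distrib)
  have conj: "1 / (B / \<sigma>) + 1 / (q * t1 / \<sigma>) = 1"
  proof -
    have "1 / (B / \<sigma>) + 1 / (q * t1 / \<sigma>) = \<sigma> * (1 / B + 1 / (q * t1))"
      by (simp add: algebra_simps)
    then show ?thesis using \<sigma>0 by (simp add: sum)
  qed
  have gt1: "x > 1" if "1 / x + 1 / y = 1" "x > 0" "y > 0" for x y :: real
  proof -
    have "1 / x < 1" using that by (smt (verit) divide_pos_pos)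
    then show ?thesis using that by simp
  qed
  have exps: "B / \<sigma> > 1" "q * t1 / \<sigma> > 1"
    using gt1[OF conj] gt1[of "q * t1 / \<sigma>" "B / \<sigma>"] conj B0 q t1 \<sigma>0 by (auto simp: add.commute)
  have sq: "s / q > 1" using s q by simp
  obtain C1 where C1: "C1 > 0" and HLS1: "\<And>(f::'a \<Rightarrow> real) g A.
    f \<in> borel_measurable borel \<Longrightarrow> g \<in> borel_measurable borel \<Longrightarrow> (\<And>y. 0 \<le> f y) \<Longrightarrow> (\<And>x. 0 \<le> g x) \<Longrightarrow>
    (\<And>x. ennreal (g x) \<le> riesz (DIM('a) - a) f x) \<Longrightarrow> A > 0 \<Longrightarrow>
    (\<integral>\<^sup>+ y. ennreal (f y powr (s / q)) \<partial>lborel) \<le> ennreal A \<Longrightarrow>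
    (\<integral>\<^sup>+ x. ennreal (g x powr t1) \<partial>lborel) \<le> ennreal (C1 * A powr (t1 / (s / q)))"
    using Hardy_Littlewood_Sobolev[where 'a = 'a, OF a sq t1] by blast
  obtain C2 where C2: "C2 > 0" and HLS2: "\<And>(f::'a \<Rightarrow> real) g A.
    f \<in> borel_measurable borel \<Longrightarrow> g \<in> borel_measurable borel \<Longrightarrow> (\<And>y. 0 \<le> f y) \<Longrightarrow> (\<And>x. 0 \<le> g x) \<Longrightarrow>
    (\<And>x. ennreal (g x) \<le> riesz (DIM('a) - a) f x) \<Longrightarrow> A > 0 \<Longrightarrow>
    (\<integral>\<^sup>+ y. ennreal (f y powr \<sigma>) \<partial>lborel) \<le> ennreal A \<Longrightarrow>
    (\<integral>\<^sup>+ x. ennreal (g x powr s) \<partial>lborel) \<le> ennreal (C2 * A powr (s / \<sigma>))"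
    using Hardy_Littlewood_Sobolev[where 'a = 'a, OF a \<sigma>(1) s0 \<sigma>(2)] by blast
  define C where "C = C2 * C1 powr (s / (q * t1))"
  have "(\<integral>\<^sup>+ x. ennreal (h x powr s) \<partial>lborel) \<le> ennreal (C * \<eta> powr (s / B) * A)"
    if [measurable]: "c \<in> borel_measurable borel" "w \<in> borel_measurable borel"
        "g \<in> borel_measurable borel" "h \<in> borel_measurable borel"
      and c0: "\<And>x. 0 \<le> c x" and w0: "\<And>x. 0 \<le> w x" and g0: "\<And>x. 0 \<le> g x" and h0: "\<And>x. 0 \<le> h x"
      and g: "\<And>x. ennreal (g x) \<le> riesz (DIM('a) - a) (\<lambda>y. w y powr q) x"
      and h: "\<And>x. ennreal (h x) \<le> riesz (DIM('a) - a) (\<lambda>y. c y * g y powr (1 / q)) x"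
      and A: "A > 0" and \<eta>: "\<eta> > 0"
      and wA: "(\<integral>\<^sup>+ x. ennreal (w x powr s) \<partial>lborel) \<le> ennreal A"
      and c\<eta>: "(\<integral>\<^sup>+ x. ennreal (c x powr B) \<partial>lborel) \<le> ennreal \<eta>"
    for c w g h :: "'a \<Rightarrow> real" and A \<eta>
  proof -
    have gt: "(\<integral>\<^sup>+ x. ennreal (g x powr t1) \<partial>lborel) \<le> ennreal (C1 * A powr (t1 / (s / q)))"
    proof (rule HLS1)
      show "(\<integral>\<^sup>+ y. ennreal ((w y powr q) powr (s / q)) \<partial>lborel) \<le> ennreal A"
        using wA q by (simp add: powr_powr)
    qed (use g g0 A in auto)
    have "(\<integral>\<^sup>+ y. ennreal (c y powr \<sigma> * g y powr (\<sigma> / q)) \<partial>lborel)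
       \<le> ennreal (\<eta> powr (1 / (B / \<sigma>)) * (C1 * A powr (t1 / (s / q))) powr (1 / (q * t1 / \<sigma>)))"
    proof (rule nn_integral_Holder)
      show "(\<integral>\<^sup>+ y. ennreal ((c y powr \<sigma>) powr (B / \<sigma>)) \<partial>lborel) \<le> ennreal \<eta>"
        using c\<eta> \<sigma>0 by (simp add: powr_powr)
      show "(\<integral>\<^sup>+ y. ennreal ((g y powr (\<sigma> / q)) powr (q * t1 / \<sigma>)) \<partial>lborel) \<le> ennreal (C1 * A powr (t1 / (s / q)))"
        using gt \<sigma>0 q by (simp add: powr_powr)
    qed (use exps conj \<eta> A C1 in auto)
    also have "(\<lambda>y. ennreal (c y powr \<sigma> * g y powr (\<sigma> / q))) = (\<lambda>y. ennreal ((c y * g y powr (1 / q)) powr \<sigma>))"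
      using c0 by (simp add: powr_mult powr_powr)
    finally have "(\<integral>\<^sup>+ x. ennreal (h x powr s) \<partial>lborel)
       \<le> ennreal (C2 * (\<eta> powr (1 / (B / \<sigma>)) * (C1 * A powr (t1 / (s / q))) powr (1 / (q * t1 / \<sigma>))) powr (s / \<sigma>))"
      using c0 g0 h0 h \<eta> A C1 by (intro HLS2) auto
    also have "(\<eta> powr (1 / (B / \<sigma>)) * (C1 * A powr (t1 / (s / q))) powr (1 / (q * t1 / \<sigma>))) powr (s / \<sigma>)
       = \<eta> powr (s / B) * (C1 powr (s / (q * t1)) * A)"
    proof -
      \<comment> \<open>By the third identity \<open>A\<close> ends up with exponent 1, as it must
        for an operator that is homogeneous of degree one.\<close>
      have e: "1 / (B / \<sigma>) * (s / \<sigma>) = s / B" "1 / (q * t1 / \<sigma>) * (s / \<sigma>) = s / (q * t1)"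
        "t1 / (s / q) * (s / (q * t1)) = 1"
        using \<sigma>0 s0 q t1(1) by simp_all
      have "(\<eta> powr (1 / (B / \<sigma>)) * (C1 * A powr (t1 / (s / q))) powr (1 / (q * t1 / \<sigma>))) powr (s / \<sigma>)
         = \<eta> powr (1 / (B / \<sigma>) * (s / \<sigma>)) * (C1 * A powr (t1 / (s / q))) powr (1 / (q * t1 / \<sigma>) * (s / \<sigma>))"
        by (simp only: powr_mult powr_powr powr_ge_zero mult.assoc)
      also have "\<dots> = \<eta> powr (s / B) * (C1 powr (s / (q * t1)) * A powr (t1 / (s / q) * (s / (q * t1))))"
        unfolding e(1,2) using C1 by (simp only: powr_mult powr_powr powr_ge_zero less_imp_le)
      also have "\<dots> = \<eta> powr (s / B) * (C1 powr (s / (q * t1)) * A)"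
        unfolding e(3) using A by simp
      finally show ?thesis .
    qed
    finally show ?thesis by (simp add: C_def mult_ac)
  qed
  moreover have "C > 0" using C1 C2 by (simp add: C_def)
  ultimately show ?thesis using that by blast
qed

text \<open>Comparison with \<open>2 * max x y\<close> works uniformly for exponents below and above
  one; both kinds occur, since \<open>q\<close> and \<open>1 / q\<close> are used.\<close>

lemma powr_add_le_two_powr:
  fixes x y r :: real
  assumes "0 \<le> x" "0 \<le> y" "0 \<le> r"
  shows "(x + y) powr r \<le> 2 powr r * (x powr r + y powr r)"
proof -
  have "(x + y) powr r \<le> (2 * max x y) powr r"
    using assms by (intro powr_mono2) auto
  also have "\<dots> = 2 powr r * max x y powr r"
    using assms by (simp add: powr_mult)
  also have "max x y powr r \<le> x powr r + y powr r"
    by (simp add: max_def)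
  finally show ?thesis by simp
qed

lemma riesz_mono:
  assumes "\<And>y. f y \<le> g y"
  shows "riesz b f x \<le> riesz b g x"
  unfolding riesz_def using assms
  by (intro nn_integral_mono ennreal_leI divide_right_mono) auto

lemma riesz_add:
  fixes f g :: "'a::euclidean_space \<Rightarrow> real"
  assumes [measurable]: "f \<in> borel_measurable borel" "g \<in> borel_measurable borel"
    and "\<And>y. 0 \<le> f y" "\<And>y. 0 \<le> g y"
  shows "riesz b (\<lambda>y. f y + g y) x = riesz b f x + riesz b g x"
  unfolding riesz_def
  by (subst nn_integral_add [symmetric]) (use assms in \<open>auto simp: add_divide_distrib\<close>)

text \<open>Continuity from above of the finite measure with density \<open>f\<close> along the
  decreasing complements of the sets \<open>A m\<close>.\<close>

lemma nn_integral_tail_small: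
  fixes f :: "'a \<Rightarrow> ennreal"
  assumes [measurable]: "f \<in> borel_measurable M" and fin: "(\<integral>\<^sup>+ x. f x \<partial>M) < \<infinity>"
    and [measurable]: "\<And>m::nat. A m \<in> sets M" and A: "incseq A" "space M \<subseteq> (\<Union>m. A m)" and e: "e > 0"
  shows "\<exists>m. (\<integral>\<^sup>+ x. f x * indicator (- A m) x \<partial>M) < e"
proof -
  let ?B = "\<lambda>m. space M - A m"
  have "(\<lambda>m. emeasure (density M f) (?B m)) \<longlonglongrightarrow> emeasure (density M f) (\<Inter>m. ?B m)"
  proof (rule Lim_emeasure_decseq)
    show "decseq ?B" using A(1) by (auto simp: decseq_def incseq_def)
    show "emeasure (density M f) (?B m) \<noteq> \<infinity>" for m
    proof -
      have "emeasure (density M f) (?B m) \<le> (\<integral>\<^sup>+ x. f x \<partial>M)"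
        by (auto simp: emeasure_density indicator_def intro!: nn_integral_mono)
      then show ?thesis using fin by (auto simp: top_unique)
    qed
  qed auto
  moreover have "emeasure (density M f) (\<Inter>m. ?B m) = emeasure (density M f) {}"
    using A(2) by (intro arg_cong[where f = "emeasure (density M f)"]) auto
  ultimately have "(\<lambda>m. emeasure (density M f) (?B m)) \<longlonglongrightarrow> 0" by (simp only: emeasure_empty)
  from order_tendstoD(2)[OF this e] obtain m where "emeasure (density M f) (?B m) < e"
    by (auto simp: eventually_sequentially)
  moreover have "emeasure (density M f) (?B m) = (\<integral>\<^sup>+ x. f x * indicator (- A m) x \<partial>M)"
    by (subst emeasure_density) (auto intro!: nn_integral_cong simp: indicator_def)
  ultimately show ?thesis by auto
qed

subsection \<open>Integrability of solutions of the system\<close>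

lemma ex_small_powr:
  fixes C e d :: real
  assumes "C > 0" "e > 0" "d > 0"
  obtains \<eta> where "\<eta> > 0" "\<And>x. 0 \<le> x \<Longrightarrow> x \<le> \<eta> \<Longrightarrow> C * x powr e \<le> d"
proof
  show "(d / C) powr (1 / e) > 0" using assms by simp
  fix x :: real assume x: "0 \<le> x" "x \<le> (d / C) powr (1 / e)"
  then have "x powr e \<le> ((d / C) powr (1 / e)) powr e"
    using assms by (intro powr_mono2) auto
  also have "\<dots> = d / C" using assms by (simp add: powr_powr)
  finally show "C * x powr e \<le> d" using assms by (simp add: field_simps)
qed

lemma nn_integral_powr_cmult_add_le:
  fixes f g :: "'a \<Rightarrow> real"
  assumes [measurable]: "f \<in> borel_measurable M" "g \<in> borel_measurable M"
    and f: "\<And>x. 0 \<le> f x" and g: "\<And>x. 0 \<le> g x" and k: "0 \<le> k" and s: "0 \<le> s"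
    and X: "(\<integral>\<^sup>+ x. ennreal (f x powr s) \<partial>M) \<le> ennreal X" "0 \<le> X"
    and Y: "(\<integral>\<^sup>+ x. ennreal (g x powr s) \<partial>M) \<le> ennreal Y" "0 \<le> Y"
  shows "(\<integral>\<^sup>+ x. ennreal ((f x + k * g x) powr s) \<partial>M) \<le> ennreal (2 powr s * (X + k powr s * Y))"
proof -
  have "(\<integral>\<^sup>+ x. ennreal ((f x + k * g x) powr s) \<partial>M)
     \<le> (\<integral>\<^sup>+ x. ennreal (2 powr s) * (ennreal (f x powr s) + ennreal (k powr s) * ennreal (g x powr s)) \<partial>M)"
  proof (rule nn_integral_mono)
    fix x
    have "(f x + k * g x) powr s \<le> 2 powr s * (f x powr s + (k * g x) powr s)"
      using f g k s by (intro powr_add_le_two_powr) auto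
    also have "(k * g x) powr s = k powr s * g x powr s"
      using k g by (simp add: powr_mult)
    finally show "ennreal ((f x + k * g x) powr s)
       \<le> ennreal (2 powr s) * (ennreal (f x powr s) + ennreal (k powr s) * ennreal (g x powr s))"
      by (simp add: ennreal_mult' [symmetric] ennreal_plus [symmetric] ennreal_leI del: ennreal_plus)
  qed
  also have "\<dots> = ennreal (2 powr s) * ((\<integral>\<^sup>+ x. ennreal (f x powr s) \<partial>M) + ennreal (k powr s) * (\<integral>\<^sup>+ x. ennreal (g x powr s) \<partial>M))"
    by (simp add: nn_integral_cmult nn_integral_add)
  also have "\<dots> \<le> ennreal (2 powr s) * (ennreal X + ennreal (k powr s) * ennreal Y)"
    by (intro mult_left_mono add_mono X Y) auto
  also have "\<dots> = ennreal (2 powr s * (X + k powr s * Y))"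
    using X Y by (simp add: ennreal_mult' [symmetric] ennreal_plus [symmetric] del: ennreal_plus)
  finally show ?thesis .
qed

text \<open>On \<open>{v \<ge> 1/m}\<close> the power \<open>v^s\<close> is at most a constant multiple of \<open>v^s'\<close>, so there the error \<open>w2\<close>
  disappears as \<open>k \<rightarrow> \<infinity>\<close>; only then does \<open>m\<close> tend to infinity.\<close>

lemma nn_integral_powr_finite_of_approx:
  fixes v :: "'a \<Rightarrow> real"
  assumes [measurable]: "v \<in> borel_measurable M" and v: "\<And>x. 0 < v x"
    and s: "0 < s" "s \<le> s'" and X: "0 \<le> X" and D: "0 \<le> D"
    and approx: "\<And>k::nat. \<exists>w1 w2. w1 \<in> borel_measurable M \<and> w2 \<in> borel_measurable M \<and>
      (\<forall>x. 0 \<le> w1 x) \<and> (\<forall>x. 0 \<le> w2 x) \<and> (\<forall>x. v x \<le> w1 x + w2 x) \<and>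
      (\<integral>\<^sup>+ x. ennreal (w1 x powr s) \<partial>M) \<le> ennreal X \<and> (\<integral>\<^sup>+ x. ennreal (w2 x powr s') \<partial>M) \<le> ennreal (D * (1 / 2) ^ k)"
  shows "(\<integral>\<^sup>+ x. ennreal (v x powr s) \<partial>M) < \<infinity>"
proof -
  define V where "V m x = ennreal (v x powr s) * indicator {x. 1 / Suc m \<le> v x} x" for m :: nat and x
  have [measurable]: "V m \<in> borel_measurable M" for m
    unfolding V_def by measurable
  have bound: "(\<integral>\<^sup>+ x. V m x \<partial>M) \<le> ennreal (2 powr s * X)" for m
  proof -
    \<comment> \<open>The second factor is the price of raising the exponent:
      \<open>v powr s \<le> Suc m powr (s' - s) * v powr s'\<close> where
      \<open>v \<ge> 1 / Suc m\<close>. The first comes from \<open>v \<le> 2 * w2\<close>. Neither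
      depends on \<open>k\<close>.\<close>
    define E where "E = 2 powr s' * Suc m powr (s' - s)"
    have le: "(\<integral>\<^sup>+ x. V m x \<partial>M) \<le> ennreal (2 powr s * X + E * D * (1 / 2) ^ k)" for k :: nat
    proof -
      obtain w1 w2 where [measurable]: "w1 \<in> borel_measurable M" "w2 \<in> borel_measurable M"
        and w0: "\<And>x. 0 \<le> w1 x" "\<And>x. 0 \<le> w2 x" and vw: "\<And>x. v x \<le> w1 x + w2 x"
        and w1: "(\<integral>\<^sup>+ x. ennreal (w1 x powr s) \<partial>M) \<le> ennreal X"
        and w2: "(\<integral>\<^sup>+ x. ennreal (w2 x powr s') \<partial>M) \<le> ennreal (D * (1 / 2) ^ k)"
        using approx[of k] by blast
      have "(\<integral>\<^sup>+ x. V m x \<partial>M)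
         \<le> (\<integral>\<^sup>+ x. ennreal (2 powr s) * ennreal (w1 x powr s) + ennreal E * ennreal (w2 x powr s') \<partial>M)"
      proof (rule nn_integral_mono)
        fix x
        have "v x powr s \<le> 2 powr s * w1 x powr s + E * w2 x powr s'" if vm: "1 / Suc m \<le> v x"
        \<comment> \<open>At every point one of \<open>w1\<close> and \<open>w2\<close> is at least
          half of \<open>v\<close>.\<close>
        proof (cases "v x \<le> 2 * w1 x")
          case True
          then have "v x powr s \<le> (2 * w1 x) powr s"
            using v s by (intro powr_mono2) (auto simp: less_imp_le)
          also have "\<dots> = 2 powr s * w1 x powr s" using w0 by (simp add: powr_mult)
          finally show ?thesis by (simp add: E_def add_increasing2)
        next
          case False
          with vw[of x] have vw2: "v x \<le> 2 * w2 x" by simp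
          have "1 \<le> Suc m * v x" using vm by (simp add: field_simps)
          then have "1 \<le> (Suc m * v x) powr (s' - s)"
            using s by (intro ge_one_powr_ge_zero) auto
          then have "v x powr s * 1 \<le> v x powr s * (Suc m * v x) powr (s' - s)"
            by (intro mult_left_mono) auto
          also have "\<dots> = Suc m powr (s' - s) * v x powr s'"
            using v[of x] by (simp add: powr_mult powr_add [symmetric])
          also have "\<dots> \<le> Suc m powr (s' - s) * (2 * w2 x) powr s'"
            using vw2 v[of x] s by (intro mult_left_mono powr_mono2) auto
          also have "\<dots> = E * w2 x powr s'"
            using w0 by (simp add: E_def powr_mult)
          finally show ?thesis by (simp add: add_increasing)
        qed
        then show "V m x \<le> ennreal (2 powr s) * ennreal (w1 x powr s) + ennreal E * ennreal (w2 x powr s')"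
          by (auto simp: V_def indicator_def E_def ennreal_mult' [symmetric] ennreal_plus [symmetric] intro!: ennreal_leI simp del: ennreal_plus)
      qed
      also have "\<dots> = ennreal (2 powr s) * (\<integral>\<^sup>+ x. ennreal (w1 x powr s) \<partial>M) + ennreal E * (\<integral>\<^sup>+ x. ennreal (w2 x powr s') \<partial>M)"
        by (simp add: nn_integral_cmult nn_integral_add)
      also have "\<dots> \<le> ennreal (2 powr s) * ennreal X + ennreal E * ennreal (D * (1 / 2) ^ k)"
        by (intro add_mono mult_left_mono w1 w2) auto
      also have "\<dots> = ennreal (2 powr s * X + E * D * (1 / 2) ^ k)"
        using X D by (simp add: E_def ennreal_mult' [symmetric] ennreal_plus [symmetric] mult.assoc del: ennreal_plus)
      finally show ?thesis .
    qed
    have "(\<lambda>k. ennreal (2 powr s * X + E * D * (1 / 2) ^ k)) \<longlonglongrightarrow> ennreal (2 powr s * X + E * D * 0)"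
      by (intro tendsto_ennrealI tendsto_intros LIMSEQ_power_zero) auto
    from LIMSEQ_le_const[OF this] le show ?thesis by auto
  qed
  \<comment> \<open>Since \<open>v\<close> is strictly positive, every point enters the sets
    \<open>{v \<ge> 1 / Suc m}\<close> eventually, so monotone convergence carries the bound over to
    the whole integral.\<close>
  have "(\<integral>\<^sup>+ x. ennreal (v x powr s) \<partial>M) = (\<integral>\<^sup>+ x. (SUP m. V m x) \<partial>M)"
  proof (rule nn_integral_cong)
    fix x
    show "ennreal (v x powr s) = (SUP m. V m x)"
    proof (rule antisym)
      obtain m where "1 / Suc m < v x"
        using reals_Archimedean[OF v[of x]] by (auto simp: inverse_eq_divide)
      then have "ennreal (v x powr s) = V m x" by (simp add: V_def)
      also have "\<dots> \<le> (SUP m. V m x)" by (rule SUP_upper) auto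
      finally show "ennreal (v x powr s) \<le> (SUP m. V m x)" .
    qed (auto simp: V_def indicator_def intro!: SUP_least)
  qed
  also have "\<dots> = (SUP m. (\<integral>\<^sup>+ x. V m x \<partial>M))"
  proof (rule nn_integral_monotone_convergence_SUP)
    show "incseq V"
    proof (intro incseq_SucI le_funI)
      fix m x
      have "1 / real (Suc (Suc m)) \<le> 1 / real (Suc m)"
        by (intro divide_left_mono) auto
      then show "V m x \<le> V (Suc m) x"
        by (auto simp: V_def indicator_def)
    qed
  qed measurable
  also have "\<dots> \<le> ennreal (2 powr s * X)"
    by (intro SUP_least bound)
  finally show ?thesis by (simp add: order_le_less_trans)
qed

text \<open>The assumptions are invariant under exchanging \<open>u\<close>, \<open>p\<close>,
  \<open>r0\<close> with \<open>v\<close>, \<open>q\<close>, \<open>s0\<close>, so a conclusion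
  about \<open>v\<close> alone also yields the one about \<open>u\<close>. Borel functions and
  \<open>lborel\<close> replace the Lebesgue setting, so that Tonelli's theorem applies
  directly.\<close>

locale riesz_system =
  fixes u v :: "'a::euclidean_space \<Rightarrow> real" and a p q b r0 s0 :: real
  defines "b \<equiv> DIM('a) - a"
    and "r0 \<equiv> DIM('a) * (p * q - 1) / (a * (q + 1))"
    and "s0 \<equiv> DIM('a) * (p * q - 1) / (a * (p + 1))"
  assumes a: "0 < a" "a < DIM('a)"
    and p: "p > 0" and q: "q > 0" and pq: "p * q > 1"
    and crit: "1 / (p + 1) + 1 / (q + 1) \<le> (DIM('a) - a) / DIM('a)"
    and u_meas [measurable]: "u \<in> borel_measurable borel" and v_meas [measurable]: "v \<in> borel_measurable borel"
    and u_pos: "\<And>x. 0 < u x" and v_pos: "\<And>x. 0 < v x"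
    and u_eq: "\<And>x. riesz b (\<lambda>y. v y powr q) x = ennreal (u x)"
    and v_eq: "\<And>x. riesz b (\<lambda>y. u y powr p) x = ennreal (v x)"
    and u_Lr0: "(\<integral>\<^sup>+ x. ennreal (u x powr r0) \<partial>lborel) < \<infinity>"
    and v_Ls0: "(\<integral>\<^sup>+ x. ennreal (v x powr s0) \<partial>lborel) < \<infinity>"
begin

text \<open>The amount by which one potential lowers a reciprocal exponent.\<close>

definition \<theta> :: real where "\<theta> = a / DIM('a)"
text \<open>The exponent of the weight in \<open>Hardy_Littlewood_Sobolev_composite\<close>. It fits
  the assumption on \<open>u\<close> because \<open>u powr (p - 1 / q)\<close> to the power
  \<open>B\<close> is \<open>u powr r0\<close>.\<close>

definition B :: real where "B = q / (\<theta> * (q + 1))"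

section \<open>Arithmetic of the exponents\<close>

lemma \<theta>_pos: "\<theta> > 0" using a by (simp add: \<theta>_def)

lemma \<theta>_le: "\<theta> \<le> 1 - 1 / (p + 1) - 1 / (q + 1)"
proof -
  have "(DIM('a) - a) / DIM('a) = 1 - \<theta>" using a by (simp add: \<theta>_def field_simps)
  then show ?thesis using crit by simp
qed

lemma \<theta>_le': "\<theta> * ((p + 1) * (q + 1)) \<le> p * q - 1"
proof -
  have "\<theta> * ((p + 1) * (q + 1)) \<le> (1 - 1 / (p + 1) - 1 / (q + 1)) * ((p + 1) * (q + 1))"
    using \<theta>_le p q by (intro mult_right_mono) auto
  also have "\<dots> = p * q - 1" using p q by (simp add: divide_simps) (simp add: algebra_simps)
  finally show ?thesis .
qed

lemma B_pos: "B > 0" using q \<theta>_pos by (simp add: B_def)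

lemma inverse_B: "1 / B = \<theta> * (1 + 1 / q)"
  using q \<theta>_pos by (simp add: B_def field_simps)

lemma r0_eq: "(p - 1 / q) * B = r0"
  using q a by (simp add: B_def r0_def \<theta>_def divide_simps)

lemma inverse_s0: "1 / s0 = \<theta> * (p + 1) / (p * q - 1)"
  by (simp add: s0_def \<theta>_def)

lemma s0_pos: "s0 > 0" using a p pq by (simp add: s0_def)

text \<open>The conditions of the composite estimate for the target exponent \<open>q + 1\<close>.
  The last two both say \<open>\<theta> < 1 - 1 / (q + 1)\<close>, and the term
  \<open>1 / (p + 1)\<close> in \<open>\<theta>_le\<close> makes that strict.\<close>

lemma exps_q1: "q + 1 > q" "q / (q + 1) > \<theta>" "1 / (q + 1) + \<theta> < 1"
proof -
  have "1 / (p + 1) > 0" using p by simp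
  moreover have "q / (q + 1) = 1 - 1 / (q + 1)" using q by (simp add: field_simps)
  ultimately show "q + 1 > q" "q / (q + 1) > \<theta>" "1 / (q + 1) + \<theta> < 1"
    using \<theta>_le by linarith+
qed

lemma q1_le_s0: "q + 1 \<le> s0"
proof -
  have "s0 = (p * q - 1) / (\<theta> * (p + 1))" using a by (simp add: s0_def \<theta>_def)
  then show ?thesis using \<theta>_le' \<theta>_pos p by (simp add: pos_le_divide_eq mult_ac)
qed

text \<open>The same conditions for the exponent \<open>s0\<close> at which integrability of
  \<open>v\<close> is given, so that one operator can be estimated in both spaces.\<close>

lemma exps_s0: "s0 > q" "q / s0 > \<theta>" "1 / s0 + \<theta> < 1"
proof -
  show "s0 > q" using q1_le_s0 by simp
  have "q / s0 = \<theta> * (q * (p + 1) / (p * q - 1))"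
    using inverse_s0 by (metis (no_types, opaque_lifting) mult.commute mult.left_commute times_divide_eq_left times_divide_eq_right mult_1)
  also have "\<dots> > \<theta> * 1"
    using \<theta>_pos pq q by (intro mult_strict_left_mono) (auto simp: algebra_simps)
  finally show "q / s0 > \<theta>" by simp
  have "1 / s0 + \<theta> = \<theta> * (p * (q + 1)) / (p * q - 1)"
    using pq unfolding inverse_s0 by (simp add: field_simps)
  also have "\<dots> < 1"
  proof -
    have "\<theta> * (p * (q + 1)) < \<theta> * ((p + 1) * (q + 1))"
      using \<theta>_pos q by simp
    then show ?thesis using \<theta>_le' pq by simp
  qed
  finally show "1 / s0 + \<theta> < 1" .
qed

end

text \<open>Adding 1 keeps the bound strictly positive even for \<open>X = 0\<close>, as the norm
  estimates above require.\<close>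

lemma ex_pos_ennreal_bound:
  assumes "X < (\<infinity>::ennreal)"
  obtains A :: real where "A > 0" "X \<le> ennreal A"
proof
  show "enn2real X + 1 > 0" by (simp add: add_nonneg_pos)
  have "X = ennreal (enn2real X)" using assms by simp
  also have "\<dots> \<le> ennreal (enn2real X + 1)" by (intro ennreal_leI) simp
  finally show "X \<le> ennreal (enn2real X + 1)" .
qed

context riesz_system
begin

lemma b_eq: "real DIM('a) - a = b" by (simp add: b_def)

text \<open>The truncated power of \<open>u\<close> is bounded and vanishes outside a ball, hence
  has every positive power integrable; one application of the Hardy-Littlewood-Sobolev inequality
  suffices.\<close>

lemma riesz_truncation_in_Lq1:
  assumes F_meas: "F \<in> borel_measurable borel" and F0: "\<And>x. 0 \<le> F x"
    and F: "\<And>x. ennreal (F x) \<le> riesz b (\<lambda>y. u y powr p * indicator {x. norm x \<le> N \<and> u x \<le> N} y) x"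
  shows "(\<integral>\<^sup>+ x. ennreal (F x powr (q + 1)) \<partial>lborel) < \<infinity>"
proof -
  define f where "f y = u y powr p * indicator {x. norm x \<le> N \<and> u x \<le> N} y" for y
  \<comment> \<open>The exponent that one potential takes to \<open>q + 1\<close>.\<close>
  define \<sigma> where "\<sigma> = 1 / (1 / (q + 1) + \<theta>)"
  have \<sigma>: "\<sigma> > 1" "1 / (q + 1) = 1 / \<sigma> - a / DIM('a)"
    using exps_q1(3) \<theta>_pos q by (auto simp: \<sigma>_def \<theta>_def [symmetric] add_pos_pos)
  have [measurable]: "f \<in> borel_measurable borel" unfolding f_def by measurable
  have f0: "f y \<ge> 0" for y by (simp add: f_def)
  have "(\<integral>\<^sup>+ y. ennreal (f y powr \<sigma>) \<partial>lborel) \<le> (\<integral>\<^sup>+ y. ennreal ((N powr p) powr \<sigma>) * indicator (cball (0::'a) N) y \<partial>lborel)"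
  proof (rule nn_integral_mono)
    fix y
    have "f y powr \<sigma> \<le> (N powr p) powr \<sigma>" if "u y \<le> N"
      using u_pos[of y] that p \<sigma>(1)
      by (intro powr_mono2) (auto simp: f_def indicator_def intro!: powr_mono2)
    then show "ennreal (f y powr \<sigma>) \<le> ennreal ((N powr p) powr \<sigma>) * indicator (cball 0 N) y"
      by (auto simp: f_def indicator_def intro!: ennreal_leI)
  qed
  also have "\<dots> = ennreal ((N powr p) powr \<sigma>) * emeasure lborel (cball (0::'a) N)"
    by (rule nn_integral_cmult_indicator) auto
  also have "\<dots> < \<infinity>"
    using emeasure_lborel_cball_finite[of "0::'a" N] by (auto simp: ennreal_mult_less_top)
  finally obtain A where A: "A > 0" "(\<integral>\<^sup>+ y. ennreal (f y powr \<sigma>) \<partial>lborel) \<le> ennreal A"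
    by (rule ex_pos_ennreal_bound)
  have q1: "q + 1 > 0" using q by simp
  obtain C where "\<And>(f::'a \<Rightarrow> real) g A.
    f \<in> borel_measurable borel \<Longrightarrow> g \<in> borel_measurable borel \<Longrightarrow> (\<And>y. 0 \<le> f y) \<Longrightarrow> (\<And>x. 0 \<le> g x) \<Longrightarrow>
    (\<And>x. ennreal (g x) \<le> riesz (DIM('a) - a) f x) \<Longrightarrow> A > 0 \<Longrightarrow>
    (\<integral>\<^sup>+ y. ennreal (f y powr \<sigma>) \<partial>lborel) \<le> ennreal A \<Longrightarrow>
    (\<integral>\<^sup>+ x. ennreal (g x powr (q + 1)) \<partial>lborel) \<le> ennreal (C * A powr ((q + 1) / \<sigma>))"
    using Hardy_Littlewood_Sobolev[where 'a = 'a, OF a \<sigma>(1) q1 \<sigma>(2)] by blast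
  from this[of f F A] have "(\<integral>\<^sup>+ x. ennreal (F x powr (q + 1)) \<partial>lborel) \<le> ennreal (C * A powr ((q + 1) / \<sigma>))"
    using F_meas F0 F f0 A unfolding b_eq f_def by simp
  then show ?thesis by (simp add: order_le_less_trans)
qed

section \<open>Cut-off sets and operators of the iteration\<close>

definition E :: "nat \<Rightarrow> 'a set" where "E m = {x. norm x \<le> m \<and> u x \<le> m}"
text \<open>The exponent leaves exactly one factor \<open>u powr (1 / q)\<close> of
  \<open>u powr p\<close>, into which the equation for \<open>u\<close> can be substituted.\<close>

definition coef :: "nat \<Rightarrow> 'a \<Rightarrow> real" where "coef m x = u x powr (p - 1 / q) * indicator (- E m) x"

text \<open>On functions dominated by \<open>v\<close> the potentials below are finite, so that \<open>enn2real\<close> loses nothing.\<close>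

definition G :: "('a \<Rightarrow> real) \<Rightarrow> 'a \<Rightarrow> real" where
  "G w x = enn2real (riesz b (\<lambda>y. w y powr q) x)"
definition T :: "nat \<Rightarrow> ('a \<Rightarrow> real) \<Rightarrow> 'a \<Rightarrow> real" where
  "T m w x = enn2real (riesz b (\<lambda>y. coef m y * G w y powr (1 / q)) x)"

lemma E_meas [measurable]: "E m \<in> sets borel"
  unfolding E_def by measurable

lemma coef_meas [measurable]: "coef m \<in> borel_measurable borel"
  unfolding coef_def [abs_def] by measurable

lemma coef_nonneg: "coef m x \<ge> 0" by (simp add: coef_def)

lemma G_meas [measurable]:
  assumes [measurable]: "w \<in> borel_measurable borel"
  shows "G w \<in> borel_measurable borel"
  unfolding G_def [abs_def] by measurable

lemma T_meas [measurable]: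
  assumes [measurable]: "w \<in> borel_measurable borel"
  shows "T m w \<in> borel_measurable borel"
  unfolding T_def [abs_def] by measurable

lemma G_nonneg: "G w x \<ge> 0" and T_nonneg: "T m w x \<ge> 0"
  by (simp_all add: G_def T_def)

lemma ennreal_G:
  assumes "\<And>x. 0 \<le> w x" "\<And>x. w x \<le> v x"
  shows "ennreal (G w x) = riesz b (\<lambda>y. w y powr q) x" and "G w x \<le> u x"
proof -
  have le: "riesz b (\<lambda>y. w y powr q) x \<le> ennreal (u x)"
    unfolding u_eq [symmetric] using assms q by (intro riesz_mono powr_mono2) auto
  then have "riesz b (\<lambda>y. w y powr q) x < \<infinity>"
    by (simp add: order_le_less_trans)
  then show eq: "ennreal (G w x) = riesz b (\<lambda>y. w y powr q) x"
    by (simp add: G_def)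
  show "G w x \<le> u x"
    using le u_pos[of x] unfolding eq [symmetric] by (simp add: ennreal_le_iff less_imp_le)
qed

lemma coef_u: "coef m x * u x powr (1 / q) = u x powr p * indicator (- E m) x"
  using u_pos[of x] by (simp add: coef_def powr_add [symmetric] indicator_def)

text \<open>Domination \<open>w \<le> v\<close> passes to \<open>G w \<le> u\<close>, so the
  integrand stays below \<open>u powr p\<close>, whose potential is the finite function
  \<open>v\<close>.\<close>

lemma ennreal_T:
  assumes "\<And>x. 0 \<le> w x" "\<And>x. w x \<le> v x"
  shows "ennreal (T m w x) = riesz b (\<lambda>y. coef m y * G w y powr (1 / q)) x"
proof -
  have "coef m y * G w y powr (1 / q) \<le> u y powr p" for y
  proof -
    have "coef m y * G w y powr (1 / q) \<le> coef m y * u y powr (1 / q)"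
      using q ennreal_G(2)[OF assms] by (intro mult_left_mono powr_mono2 coef_nonneg) (auto simp: G_nonneg)
    also have "\<dots> \<le> u y powr p"
      unfolding coef_u by (simp add: indicator_def)
    finally show ?thesis .
  qed
  then have "riesz b (\<lambda>y. coef m y * G w y powr (1 / q)) x \<le> ennreal (v x)"
    unfolding v_eq [symmetric] by (rule riesz_mono)
  then have "riesz b (\<lambda>y. coef m y * G w y powr (1 / q)) x < \<infinity>"
    by (simp add: order_le_less_trans)
  then show ?thesis by (simp add: T_def)
qed

definition F :: "nat \<Rightarrow> 'a \<Rightarrow> real" where
  "F m x = enn2real (riesz b (\<lambda>y. u y powr p * indicator (E m) y) x)"

text \<open>The constant in the subadditivity of the operator: 2 is \<open>2 powr q\<close> after
  taking the root \<open>1 / q\<close>, and \<open>2 powr (1 / q)\<close> comes from splitting the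
  root of a sum.\<close>

definition K :: real where "K = 2 * 2 powr (1 / q)"

lemma K_pos: "K > 0" by (simp add: K_def)

lemma F_meas [measurable]: "F m \<in> borel_measurable borel"
  unfolding F_def [abs_def] by measurable

lemma ennreal_F: "ennreal (F m x) = riesz b (\<lambda>y. u y powr p * indicator (E m) y) x"
proof -
  have "riesz b (\<lambda>y. u y powr p * indicator (E m) y) x \<le> ennreal (v x)"
    unfolding v_eq [symmetric] by (rule riesz_mono) (simp add: indicator_def)
  then have "riesz b (\<lambda>y. u y powr p * indicator (E m) y) x < \<infinity>"
    by (simp add: order_le_less_trans)
  then show ?thesis by (simp add: F_def)
qed

text \<open>One step of the iteration, as an inequality: a splitting of \<open>v\<close> gives one
  of \<open>u\<close> through the first equation, and inserting the latter into the second equation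
  off \<open>E m\<close> gives a new splitting of \<open>v\<close>.\<close>

lemma v_le_F_T:
  assumes [measurable]: "w1 \<in> borel_measurable borel" "w2 \<in> borel_measurable borel"
    and w1: "\<And>x. 0 \<le> w1 x" "\<And>x. w1 x \<le> v x" and w2: "\<And>x. 0 \<le> w2 x" "\<And>x. w2 x \<le> v x"
    and vw: "\<And>x. v x \<le> w1 x + w2 x"
  shows "v x \<le> F m x + K * T m w1 x + K * T m w2 x"
proof -
  have u_le: "u y \<le> 2 powr q * (G w1 y + G w2 y)" for y
  proof -
    have "v z powr q \<le> 2 powr q * (w1 z powr q + w2 z powr q)" for z
    proof -
      have "v z powr q \<le> (w1 z + w2 z) powr q"
        using vw v_pos[of z] q by (intro powr_mono2) auto
      also have "\<dots> \<le> 2 powr q * (w1 z powr q + w2 z powr q)"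
        using w1 w2 q by (intro powr_add_le_two_powr) auto
      finally show ?thesis .
    qed
    then have "ennreal (u y) \<le> riesz b (\<lambda>z. 2 powr q * (w1 z powr q + w2 z powr q)) y"
      unfolding u_eq [symmetric] by (rule riesz_mono)
    also have "\<dots> = ennreal (2 powr q) * (ennreal (G w1 y) + ennreal (G w2 y))"
      by (simp add: riesz_cmult riesz_add ennreal_G(1)[OF w1] ennreal_G(1)[OF w2])
    also have "\<dots> = ennreal (2 powr q * (G w1 y + G w2 y))"
      by (simp add: G_nonneg ennreal_mult' [symmetric] ennreal_plus [symmetric] del: ennreal_plus)
    finally show ?thesis
      by (subst (asm) ennreal_le_iff) (auto simp: G_nonneg)
  qed
  have "u y powr p \<le> u y powr p * indicator (E m) y
      + K * (coef m y * G w1 y powr (1 / q) + coef m y * G w2 y powr (1 / q))" for y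
  proof -
    have "u y powr (1 / q) \<le> (2 powr q * (G w1 y + G w2 y)) powr (1 / q)"
      using u_le u_pos[of y] q by (intro powr_mono2) auto
    also have "\<dots> = 2 * (G w1 y + G w2 y) powr (1 / q)"
      using q by (simp add: powr_mult powr_powr G_nonneg)
    also have "\<dots> \<le> 2 * (2 powr (1 / q) * (G w1 y powr (1 / q) + G w2 y powr (1 / q)))"
      using q by (intro mult_left_mono powr_add_le_two_powr) (auto simp: G_nonneg)
    finally have "coef m y * u y powr (1 / q) \<le> coef m y * (K * (G w1 y powr (1 / q) + G w2 y powr (1 / q)))"
      by (intro mult_left_mono coef_nonneg) (simp add: K_def)
    moreover have "u y powr p = u y powr p * indicator (E m) y + coef m y * u y powr (1 / q)"
      unfolding coef_u by (simp add: indicator_def)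
    ultimately show ?thesis by (simp add: algebra_simps)
  qed
  then have "ennreal (v x) \<le> riesz b (\<lambda>y. u y powr p * indicator (E m) y
      + K * (coef m y * G w1 y powr (1 / q) + coef m y * G w2 y powr (1 / q))) x"
    unfolding v_eq [symmetric] by (rule riesz_mono)
  also have "\<dots> = ennreal (F m x) + ennreal K * (ennreal (T m w1 x) + ennreal (T m w2 x))"
    using K_pos by (simp add: riesz_add riesz_cmult coef_nonneg ennreal_F ennreal_T[OF w1] ennreal_T[OF w2])
  also have "\<dots> = ennreal (F m x + K * T m w1 x + K * T m w2 x)"
    using K_pos by (simp add: F_def T_nonneg ennreal_mult' [symmetric] ennreal_plus [symmetric] algebra_simps del: ennreal_plus)
  finally show ?thesis
    using K_pos by (subst (asm) ennreal_le_iff) (auto simp: F_def T_nonneg)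
qed

text \<open>By the choice of \<open>B\<close> the integrand is \<open>u powr r0\<close> off
  \<open>E m\<close>. The sets \<open>E m\<close> exhaust the space, so this is a tail of a finite
  integral.\<close>

lemma coef_small:
  assumes "\<eta> > 0"
  shows "\<exists>m. (\<integral>\<^sup>+ x. ennreal (coef m x powr B) \<partial>lborel) \<le> ennreal \<eta>"
proof -
  have "\<exists>m. (\<integral>\<^sup>+ x. ennreal (u x powr r0) * indicator (- E m) x \<partial>lborel) < ennreal \<eta>"
  proof (rule nn_integral_tail_small)
    show "incseq E" by (intro incseq_SucI) (auto simp: E_def)
    have "\<exists>m::nat. x \<in> E m" for x
      using real_arch_simple[of "max (norm x) (u x)"] by (auto simp: E_def)
    then show "space lborel \<subseteq> (\<Union>m. E m)" by auto
  qed (use u_Lr0 assms in auto)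
  then obtain m where "(\<integral>\<^sup>+ x. ennreal (u x powr r0) * indicator (- E m) x \<partial>lborel) < ennreal \<eta>" ..
  also have "(\<integral>\<^sup>+ x. ennreal (u x powr r0) * indicator (- E m) x \<partial>lborel) = (\<integral>\<^sup>+ x. ennreal (coef m x powr B) \<partial>lborel)"
    by (intro nn_integral_cong) (auto simp: coef_def indicator_def powr_powr r0_eq)
  finally show ?thesis by (auto intro: less_imp_le)
qed

text \<open>The composite estimate for \<open>coef m\<close>, \<open>G w\<close> and
  \<open>T m w\<close>. What matters is that \<open>C\<close> is independent of \<open>m\<close>, so
  that \<open>m\<close> can be chosen afterwards to make \<eta> small.\<close>

lemma T_bound:
  assumes "s > q" "q / s > \<theta>" "1 / s + \<theta> < 1"
  obtains C where "C > 0" "\<And>m w A \<eta>. w \<in> borel_measurable borel \<Longrightarrow> (\<And>x. 0 \<le> w x) \<Longrightarrow> (\<And>x. w x \<le> v x) \<Longrightarrow>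
      A > 0 \<Longrightarrow> \<eta> > 0 \<Longrightarrow> (\<integral>\<^sup>+ x. ennreal (w x powr s) \<partial>lborel) \<le> ennreal A \<Longrightarrow>
      (\<integral>\<^sup>+ x. ennreal (coef m x powr B) \<partial>lborel) \<le> ennreal \<eta> \<Longrightarrow>
      (\<integral>\<^sup>+ x. ennreal (T m w x powr s) \<partial>lborel) \<le> ennreal (C * \<eta> powr (s / B) * A)"
proof -
  have iB: "1 / B = a / DIM('a) * (1 + 1 / q)" using inverse_B by (simp add: \<theta>_def)
  obtain C where C: "C > 0" and HLS: "\<And>(c::'a \<Rightarrow> real) w g h A \<eta>.
    c \<in> borel_measurable borel \<Longrightarrow> w \<in> borel_measurable borel \<Longrightarrow>
    g \<in> borel_measurable borel \<Longrightarrow> h \<in> borel_measurable borel \<Longrightarrow>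
    (\<And>x. 0 \<le> c x) \<Longrightarrow> (\<And>x. 0 \<le> w x) \<Longrightarrow> (\<And>x. 0 \<le> g x) \<Longrightarrow> (\<And>x. 0 \<le> h x) \<Longrightarrow>
    (\<And>x. ennreal (g x) \<le> riesz b (\<lambda>y. w y powr q) x) \<Longrightarrow>
    (\<And>x. ennreal (h x) \<le> riesz b (\<lambda>y. c y * g y powr (1 / q)) x) \<Longrightarrow>
    A > 0 \<Longrightarrow> \<eta> > 0 \<Longrightarrow>
    (\<integral>\<^sup>+ x. ennreal (w x powr s) \<partial>lborel) \<le> ennreal A \<Longrightarrow>
    (\<integral>\<^sup>+ x. ennreal (c x powr B) \<partial>lborel) \<le> ennreal \<eta> \<Longrightarrow>
    (\<integral>\<^sup>+ x. ennreal (h x powr s) \<partial>lborel) \<le> ennreal (C * \<eta> powr (s / B) * A)"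
    using Hardy_Littlewood_Sobolev_composite[where 'a = 'a, OF a q iB, folded \<theta>_def, OF assms, unfolded b_eq]
    by blast
  show ?thesis
  proof (rule that[OF C])
    fix m w A \<eta>
    assume w: "w \<in> borel_measurable borel" "\<And>x. 0 \<le> w x" "\<And>x. w x \<le> v x" and A: "A > 0" "\<eta> > 0"
      "(\<integral>\<^sup>+ x. ennreal (w x powr s) \<partial>lborel) \<le> ennreal A" "(\<integral>\<^sup>+ x. ennreal (coef m x powr B) \<partial>lborel) \<le> ennreal \<eta>"
    note [measurable] = w(1)
    show "(\<integral>\<^sup>+ x. ennreal (T m w x powr s) \<partial>lborel) \<le> ennreal (C * \<eta> powr (s / B) * A)"
      by (rule HLS[of "coef m" w "G w" "T m w" A \<eta>])
        (use w A in \<open>auto simp: coef_nonneg G_nonneg T_nonneg ennreal_G(1)[OF w(2,3)] ennreal_T[OF w(2,3)]\<close>)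
  qed
qed

text \<open>Order of choices: first the operator constants for both exponents, then \<eta>, then
  \<open>m\<close>, and only then the bound \<open>M0\<close> for \<open>F m\<close>. All of them
  are fixed before the number \<open>k\<close> of iterations.\<close>

lemma v_in_Lq1: "(\<integral>\<^sup>+ x. ennreal (v x powr (q + 1)) \<partial>lborel) < \<infinity>"
proof -
  obtain C1 where C1: "C1 > 0" and T1: "\<And>m w A \<eta>. w \<in> borel_measurable borel \<Longrightarrow> (\<And>x. 0 \<le> w x) \<Longrightarrow> (\<And>x. w x \<le> v x) \<Longrightarrow>
      A > 0 \<Longrightarrow> \<eta> > 0 \<Longrightarrow> (\<integral>\<^sup>+ x. ennreal (w x powr (q + 1)) \<partial>lborel) \<le> ennreal A \<Longrightarrow>
      (\<integral>\<^sup>+ x. ennreal (coef m x powr B) \<partial>lborel) \<le> ennreal \<eta> \<Longrightarrow>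
      (\<integral>\<^sup>+ x. ennreal (T m w x powr (q + 1)) \<partial>lborel) \<le> ennreal (C1 * \<eta> powr ((q + 1) / B) * A)"
    using T_bound[OF exps_q1] by blast
  obtain C2 where C2: "C2 > 0" and T2: "\<And>m w A \<eta>. w \<in> borel_measurable borel \<Longrightarrow> (\<And>x. 0 \<le> w x) \<Longrightarrow> (\<And>x. w x \<le> v x) \<Longrightarrow>
      A > 0 \<Longrightarrow> \<eta> > 0 \<Longrightarrow> (\<integral>\<^sup>+ x. ennreal (w x powr s0) \<partial>lborel) \<le> ennreal A \<Longrightarrow>
      (\<integral>\<^sup>+ x. ennreal (coef m x powr B) \<partial>lborel) \<le> ennreal \<eta> \<Longrightarrow>
      (\<integral>\<^sup>+ x. ennreal (T m w x powr s0) \<partial>lborel) \<le> ennreal (C2 * \<eta> powr (s0 / B) * A)"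
    using T_bound[OF exps_s0] by blast
  have q1: "q + 1 > 0" using q by simp
  \<comment> \<open>\<eta>1 makes the image of the regular part take up at most half of its bound;
    \<eta>2 makes the integral of the error shrink by the factor 1/2 in each step.\<close>
  obtain \<eta>1 where \<eta>1: "\<eta>1 > 0" "\<And>x. 0 \<le> x \<Longrightarrow> x \<le> \<eta>1 \<Longrightarrow> 2 powr (q + 1) * K powr (q + 1) * C1 * x powr ((q + 1) / B) \<le> 1 / 2"
    using ex_small_powr[of "2 powr (q + 1) * K powr (q + 1) * C1" "(q + 1) / B" "1 / 2"] K_pos C1 q1 B_pos by auto
  obtain \<eta>2 where \<eta>2: "\<eta>2 > 0" "\<And>x. 0 \<le> x \<Longrightarrow> x \<le> \<eta>2 \<Longrightarrow> K powr s0 * C2 * x powr (s0 / B) \<le> 1 / 2"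
    using ex_small_powr[of "K powr s0 * C2" "s0 / B" "1 / 2"] K_pos C2 s0_pos B_pos by auto
  define \<eta> where "\<eta> = min \<eta>1 \<eta>2"
  have \<eta>: "\<eta> > 0" "2 powr (q + 1) * K powr (q + 1) * C1 * \<eta> powr ((q + 1) / B) \<le> 1 / 2"
      "K powr s0 * C2 * \<eta> powr (s0 / B) \<le> 1 / 2"
    using \<eta>1(1) \<eta>2(1) \<eta>1(2)[of \<eta>] \<eta>2(2)[of \<eta>] by (auto simp: \<eta>_def)
  obtain m where m: "(\<integral>\<^sup>+ x. ennreal (coef m x powr B) \<partial>lborel) \<le> ennreal \<eta>"
    using coef_small[OF \<eta>(1)] by blast
  have "(\<integral>\<^sup>+ x. ennreal (F m x powr (q + 1)) \<partial>lborel) < \<infinity>"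
    by (rule riesz_truncation_in_Lq1[where N = "real m"]) (auto simp: ennreal_F E_def, simp add: F_def)
  then obtain M0 where M0: "M0 > 0" "(\<integral>\<^sup>+ x. ennreal (F m x powr (q + 1)) \<partial>lborel) \<le> ennreal M0"
    by (rule ex_pos_ennreal_bound)
  obtain D where D: "D > 0" "(\<integral>\<^sup>+ x. ennreal (v x powr s0) \<partial>lborel) \<le> ennreal D"
    using v_Ls0 by (rule ex_pos_ennreal_bound)
  \<comment> \<open>Chosen to be preserved by the iteration: \<open>F m\<close> contributes
    \<open>2 powr (q + 1) * M0 = M / 2\<close>, and the operator term contributes at most the other
    half.\<close>
  define M where "M = 2 * 2 powr (q + 1) * M0"
  have M: "M > 0" using M0 by (simp add: M_def)
  have approx: "\<exists>w1 w2. w1 \<in> borel_measurable borel \<and> w2 \<in> borel_measurable borel \<and>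
      (\<forall>x. 0 \<le> w1 x) \<and> (\<forall>x. 0 \<le> w2 x) \<and> (\<forall>x. w1 x \<le> v x) \<and> (\<forall>x. w2 x \<le> v x) \<and> (\<forall>x. v x \<le> w1 x + w2 x) \<and>
      (\<integral>\<^sup>+ x. ennreal (w1 x powr (q + 1)) \<partial>lborel) \<le> ennreal M \<and>
      (\<integral>\<^sup>+ x. ennreal (w2 x powr s0) \<partial>lborel) \<le> ennreal (D * (1 / 2) ^ k)" for k :: nat
  proof (induction k)
    case 0
    \<comment> \<open>At the start all of \<open>v\<close> counts as error, with \<open>D\<close>
      bounding its integral of exponent \<open>s0\<close>.\<close>
    show ?case
      by (rule exI[of _ "\<lambda>_. 0"], rule exI[of _ v]) (use v_pos D in \<open>auto simp: less_imp_le\<close>)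
  next
    case (Suc k)
    then obtain w1 w2 where [measurable]: "w1 \<in> borel_measurable borel" "w2 \<in> borel_measurable borel"
      and w1: "\<And>x. 0 \<le> w1 x" "\<And>x. w1 x \<le> v x" and w2: "\<And>x. 0 \<le> w2 x" "\<And>x. w2 x \<le> v x"
      and vw: "\<And>x. v x \<le> w1 x + w2 x"
      and b1: "(\<integral>\<^sup>+ x. ennreal (w1 x powr (q + 1)) \<partial>lborel) \<le> ennreal M"
      and b2: "(\<integral>\<^sup>+ x. ennreal (w2 x powr s0) \<partial>lborel) \<le> ennreal (D * (1 / 2) ^ k)"
      by blast
    \<comment> \<open>Capping both parts at \<open>v\<close> keeps their potentials finite in the
      next step. Their sum still dominates \<open>v\<close>: either one of them equals
      \<open>v\<close>, or neither is capped and \<open>v_le_F_T\<close> applies.\<close>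
    define z1 where "z1 x = min (v x) (F m x + K * T m w1 x)" for x
    define z2 where "z2 x = min (v x) (K * T m w2 x)" for x
    have F0: "F m x \<ge> 0" for x by (simp add: F_def)
    have z1: "0 \<le> z1 x" "z1 x \<le> v x" "z1 x \<le> F m x + K * T m w1 x" for x
      using v_pos[of x] K_pos T_nonneg[of m w1 x] F0[of x] by (auto simp: z1_def)
    have z2: "0 \<le> z2 x" "z2 x \<le> v x" "z2 x \<le> K * T m w2 x" for x
      using v_pos[of x] K_pos T_nonneg[of m w2 x] by (auto simp: z2_def)
    have "v x \<le> z1 x + z2 x" for x
      using v_le_F_T[OF _ _ w1 w2 vw, of x m] z1[of x] z2[of x] by (auto simp: z1_def z2_def min_def)
    moreover have "(\<integral>\<^sup>+ x. ennreal (z1 x powr (q + 1)) \<partial>lborel) \<le> ennreal M"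
    proof -
      have "(\<integral>\<^sup>+ x. ennreal (z1 x powr (q + 1)) \<partial>lborel) \<le> (\<integral>\<^sup>+ x. ennreal ((F m x + K * T m w1 x) powr (q + 1)) \<partial>lborel)"
        using z1 q by (intro nn_integral_mono ennreal_leI powr_mono2) auto
      also have "\<dots> \<le> ennreal (2 powr (q + 1) * (M0 + K powr (q + 1) * (C1 * \<eta> powr ((q + 1) / B) * M)))"
        using T1[OF _ w1 M \<eta>(1) b1 m] M0 K_pos q C1 M
        by (intro nn_integral_powr_cmult_add_le) (auto simp: F0 T_nonneg)
      also have "2 powr (q + 1) * (M0 + K powr (q + 1) * (C1 * \<eta> powr ((q + 1) / B) * M))
          = M / 2 + (2 powr (q + 1) * K powr (q + 1) * C1 * \<eta> powr ((q + 1) / B)) * M"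
        by (simp add: M_def algebra_simps)
      also have "ennreal \<dots> \<le> ennreal (M / 2 + 1 / 2 * M)"
        using \<eta>(2) M by (intro ennreal_leI add_left_mono mult_right_mono) auto
      finally show ?thesis by simp
    qed
    moreover have "(\<integral>\<^sup>+ x. ennreal (z2 x powr s0) \<partial>lborel) \<le> ennreal (D * (1 / 2) ^ Suc k)"
    proof -
      have "(\<integral>\<^sup>+ x. ennreal (z2 x powr s0) \<partial>lborel) \<le> (\<integral>\<^sup>+ x. ennreal ((K * T m w2 x) powr s0) \<partial>lborel)"
        using z2 s0_pos by (intro nn_integral_mono ennreal_leI powr_mono2) auto
      also have "\<dots> = (\<integral>\<^sup>+ x. ennreal (K powr s0) * ennreal (T m w2 x powr s0) \<partial>lborel)"
        using K_pos by (simp add: powr_mult T_nonneg ennreal_mult' [symmetric])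
      also have "\<dots> = ennreal (K powr s0) * (\<integral>\<^sup>+ x. ennreal (T m w2 x powr s0) \<partial>lborel)"
        by (rule nn_integral_cmult) measurable
      also have "\<dots> \<le> ennreal (K powr s0) * ennreal (C2 * \<eta> powr (s0 / B) * (D * (1 / 2) ^ k))"
        using T2[OF _ w2 _ \<eta>(1) b2 m] D by (intro mult_left_mono) auto
      also have "\<dots> = ennreal ((K powr s0 * C2 * \<eta> powr (s0 / B)) * (D * (1 / 2) ^ k))"
        using C2 D by (simp add: ennreal_mult' [symmetric] mult_ac)
      also have "\<dots> \<le> ennreal (1 / 2 * (D * (1 / 2) ^ k))"
        using \<eta>(3) D by (intro ennreal_leI mult_right_mono) auto
      finally show ?thesis by (simp add: mult_ac)
    qed
    ultimately show ?case
      by (intro exI[of _ z1] exI[of _ z2]) (use z1 z2 in \<open>auto simp: z1_def [abs_def] z2_def [abs_def]\<close>)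
  qed
  show ?thesis
  proof (rule nn_integral_powr_finite_of_approx[where s' = s0 and X = M and D = D])
    fix k :: nat
    show "\<exists>w1 w2. w1 \<in> borel_measurable lborel \<and> w2 \<in> borel_measurable lborel \<and>
      (\<forall>x. 0 \<le> w1 x) \<and> (\<forall>x. 0 \<le> w2 x) \<and> (\<forall>x. v x \<le> w1 x + w2 x) \<and>
      (\<integral>\<^sup>+ x. ennreal (w1 x powr (q + 1)) \<partial>lborel) \<le> ennreal M \<and> (\<integral>\<^sup>+ x. ennreal (w2 x powr s0) \<partial>lborel) \<le> ennreal (D * (1 / 2) ^ k)"
      using approx[of k] by (elim ex_forward) simp
  qed (use v_pos q1 q1_le_s0 M D in auto)
qed

end

section \<open>Passage from Lebesgue to Borel measurable functions\<close>

lemma riesz_int_eq_riesz: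
  fixes g :: "real^'n \<Rightarrow> real" and \<alpha> :: real
  shows "riesz_int \<alpha> e g x = riesz (CARD('n) - \<alpha>) (\<lambda>y. g y powr e) x"
  by (simp add: riesz_int_def riesz_def nn_integral_completion)

text \<open>A Lebesgue measurable \<open>g\<close> agrees almost everywhere with a Borel function,
  and the potential ignores null sets. As the identity holds at every point, \<open>h\<close> equals
  the potential of that Borel function everywhere and not merely almost everywhere.\<close>

lemma borel_measurable_of_riesz_int:
  fixes g h :: "real^'n \<Rightarrow> real"
  assumes "g \<in> borel_measurable lebesgue" and h: "\<And>x. riesz_int \<alpha> e g x = ennreal (h x)" "\<And>x. 0 < h x"
  shows "h \<in> borel_measurable borel"
proof -
  obtain g' where g'_meas: "g' \<in> borel_measurable lborel" and g': "AE x in lborel. g x = g' x"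
    using completion_ex_borel_measurable_real[OF assms(1)] by blast
  then have [measurable]: "g' \<in> borel_measurable borel" by simp
  have "riesz (CARD('n) - \<alpha>) (\<lambda>y. g y powr e) x = riesz (CARD('n) - \<alpha>) (\<lambda>y. g' y powr e) x" for x
    unfolding riesz_def using g' by (intro nn_integral_cong_AE) auto
  then have "h = (\<lambda>x. enn2real (riesz (CARD('n) - \<alpha>) (\<lambda>y. g' y powr e) x))"
    using h by (auto simp: riesz_int_eq_riesz fun_eq_iff less_imp_le)
  also have "\<dots> \<in> borel_measurable borel" by measurable
  finally show ?thesis .
qed

lemma in_Lp_iff_lborel:
  fixes f :: "real^'n \<Rightarrow> real"
  assumes "f \<in> borel_measurable borel" "\<And>x. 0 < f x"
  shows "in_Lp r f \<longleftrightarrow> (\<integral>\<^sup>+ x. ennreal (f x powr r) \<partial>lborel) < \<infinity>"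
  using assms by (simp add: in_Lp_def nn_integral_completion measurable_completion less_imp_le abs_of_pos)

theorem theorem2p2:
  fixes u v :: "real^'n \<Rightarrow> real" and \<alpha> p q :: real
  assumes "CARD('n) \<ge> 3"
    and "0 < \<alpha>" and "\<alpha> < real CARD('n)"
    and "p > 0" and "q > 0" and "p * q > 1"
    and "1 / (p + 1) + 1 / (q + 1) \<le> (real CARD('n) - \<alpha>) / real CARD('n)"
    and "in_Lp (real CARD('n) * (p * q - 1) / (\<alpha> * (q + 1))) u"
    and "in_Lp (real CARD('n) * (p * q - 1) / (\<alpha> * (p + 1))) v"
    and "positive_solution \<alpha> p q u v"
  shows "in_Lp (p + 1) u \<and> in_Lp (q + 1) v"
proof -
  have pos: "\<And>x. 0 < u x" "\<And>x. 0 < v x"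
    and eqs: "\<And>x. riesz_int \<alpha> q v x = ennreal (u x)" "\<And>x. riesz_int \<alpha> p u x = ennreal (v x)"
    and meas: "u \<in> borel_measurable lebesgue" "v \<in> borel_measurable lebesgue"
    using assms(10) by (auto simp: positive_solution_def)
  have borel: "u \<in> borel_measurable borel" "v \<in> borel_measurable borel"
    using borel_measurable_of_riesz_int[OF meas(2) eqs(1) pos(1)]
      borel_measurable_of_riesz_int[OF meas(1) eqs(2) pos(2)] by auto
  note Lp_iff = in_Lp_iff_lborel[OF borel(1) pos(1)] in_Lp_iff_lborel[OF borel(2) pos(2)]
  have "riesz_system u v \<alpha> p q"
    by (rule riesz_system.intro) (use assms(2-9) pos eqs borel in \<open>auto simp: riesz_int_eq_riesz Lp_iff\<close>)
  \<comment> \<open>With the roles exchanged, \<open>v_in_Lq1\<close> becomes the statement that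
    \<open>u powr (p + 1)\<close> is integrable.\<close>
  moreover have "riesz_system v u \<alpha> q p"
    by (rule riesz_system.intro)
      (use assms(2-9) pos eqs borel in \<open>auto simp: riesz_int_eq_riesz Lp_iff mult.commute[of q p] add.commute[of "1 / (q + 1)"]\<close>)
  ultimately show ?thesis
    unfolding Lp_iff by (blast intro: riesz_system.v_in_Lq1)
qed

end
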